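(* There exists a polynomial-time Turing reduction from $\mathrm{dMFE}$ to $\mathrm{dPF}$, where the dPF oracle may be called on magnified energy models $\mathcal{M}'$ with $\Delta G^{\mathcal{M}'}=\alpha\cdot\Delta G^{\mathcal{M}}$ for a positive real $\alpha$ computed by the reduction.
   Context: A nucleic acid strand is a word over $\{A,C,G,T\}$; inputs may be a single strand or a multiset of strands, $n$ the total number of bases. A secondary structure is a set of complementary base pairs with each base in at most one pair; $\Omega_s$ is the set of secondary structures under interest of $s$. An energy model $\mathcal{M}$ is part of the problem input and assigns $\Delta G^{\mathcal{M}}(S,T)\in\mathbb{R}$ to each $S\in\Omega_s$ at temperature $T$; for $\alpha>0$ the magnified model has energies multiplied by $\alpha$. $\mathrm{MFE}(s,T,\mathcal{M})=\min_{S\in\Omega_s}\Delta G^{\mathcal{M}}(S,T)$ and $\mathrm{PF}(s,T,\mathcal{M})=\sum_{S\in\Omega_s}e^{-\Delta G^{\mathcal{M}}(S,T)/k_BT}$. dMFE: given $(s,T,\mathcal{M},k)$ decide whether $\mathrm{MFE}\le k$; dPF: given $(s,T,\mathcal{M},k)$ decide whether $\mathrm{PF}\ge k$. Standing assumption: there is a set of candidate energy levels (a finite superset of $\{\Delta G^{\mathcal{M}}(S):S\in\Omega_s\}$) of size polynomial in $n$, computable in polynomial time, consisting of rationals with $O(\log n)$-digit precision (so the minimal gap $\delta$ between distinct levels satisfies that $\log(1/\delta)$ is polynomially bounded). A polynomial-time Turing reduction from $A$ to $B$ solves $A$ using polynomially many calls to an oracle for $B$ and polynomial additional time. *)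

theory Defs
  imports
    Complex_Main
    "HOL-Library.Log_Nat"
    "HOL-Computational_Algebra.Polynomial"
begin

section \<open>Secondary structures and energy models\<close>

datatype base = Ade | Cyt | Gua | Thy

fun complementary :: "base \<Rightarrow> base \<Rightarrow> bool" where
  "complementary Ade Thy = True"
| "complementary Thy Ade = True"
| "complementary Cyt Gua = True"
| "complementary Gua Cyt = True"
| "complementary _ _ = False"

type_synonym strand = "base list"

text \<open>
  An input is a multiset of strands, listed in some order; a single strand is a one-element list.
  The site \<open>(i, j)\<close> is the \<open>j\<close>-th base of the \<open>i\<close>-th strand.
\<close>

type_synonym site = "nat \<times> nat"
type_synonym sec_structure = "site set set"

definition num_bases :: "strand list \<Rightarrow> nat" where
  "num_bases s = sum_list (map length s)"

definition sites :: "strand list \<Rightarrow> site set" where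
  "sites s = {(i, j). i < length s \<and> j < length (s ! i)}"

definition base_at :: "strand list \<Rightarrow> site \<Rightarrow> base" where
  "base_at s x = s ! fst x ! snd x"

definition base_pairs :: "strand list \<Rightarrow> site set set" where
  "base_pairs s =
    {{x, y} | x y. x \<in> sites s \<and> y \<in> sites s \<and> complementary (base_at s x) (base_at s y)}"

definition secondary_structures :: "strand list \<Rightarrow> sec_structure set" where
  "secondary_structures s = {S. S \<subseteq> base_pairs s \<and> pairwise disjnt S}"

text \<open>
  An energy function takes the strands, the temperature and a structure; the strands are an
  argument because a set of pairs of sites does not determine the bases at these sites.
\<close>

type_synonym energy = "strand list \<Rightarrow> real \<Rightarrow> sec_structure \<Rightarrow> real"

definition magnify :: "real \<Rightarrow> energy \<Rightarrow> energy" where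
  "magnify \<alpha> E = (\<lambda>s T S. \<alpha> * E s T S)"

definition MFE :: "(strand list \<Rightarrow> sec_structure set) \<Rightarrow> energy \<Rightarrow> strand list \<Rightarrow> real \<Rightarrow> real" where
  "MFE \<Omega> E s T = Min (E s T ` \<Omega> s)"

definition PF ::
  "real \<Rightarrow> (strand list \<Rightarrow> sec_structure set) \<Rightarrow> energy \<Rightarrow> strand list \<Rightarrow> real \<Rightarrow> real" where
  "PF kB \<Omega> E s T = (\<Sum>S\<in>\<Omega> s. exp (- E s T S / (kB * T)))"

section \<open>Polynomial time\<close>

text \<open>
  Programs are while programs over finite trees with integer leaves, under the logarithmic cost
  criterion: each operation is charged the bit size of its result, and the evaluation of an operand
  has been charged the bit size of that operand. The size of a computed value is therefore at most
  linear in the size of the input plus the time used, and every operation can be carried out by a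
  multitape Turing machine in time polynomial in its charge, so that polynomial time agrees with
  that of (oracle) Turing machines.
\<close>

datatype data = Num int | Cell data data

fun bit_size :: "data \<Rightarrow> nat" where
  "bit_size (Num i) = 1 + floorlog 2 (nat \<bar>i\<bar>)"
| "bit_size (Cell a b) = 1 + bit_size a + bit_size b"

fun the_num :: "data \<Rightarrow> int" where
  "the_num (Num i) = i"
| "the_num (Cell a b) = 0"

fun left :: "data \<Rightarrow> data" where
  "left (Num i) = Num 0"
| "left (Cell a b) = a"

fun right :: "data \<Rightarrow> data" where
  "right (Num i) = Num 0"
| "right (Cell a b) = b"

fun is_cell :: "data \<Rightarrow> bool" where
  "is_cell (Num i) = False"
| "is_cell (Cell a b) = True"

datatype exp =
    Var nat | Lit int
  | Mk exp exp | Left exp | Right exp | IsCell exp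
  | Add exp exp | Sub exp exp | Mul exp exp | Div exp exp | Less exp exp

type_synonym store = "nat \<Rightarrow> data"

fun val :: "exp \<Rightarrow> store \<Rightarrow> data" where
  "val (Var x) \<sigma> = \<sigma> x"
| "val (Lit i) \<sigma> = Num i"
| "val (Mk e f) \<sigma> = Cell (val e \<sigma>) (val f \<sigma>)"
| "val (Left e) \<sigma> = left (val e \<sigma>)"
| "val (Right e) \<sigma> = right (val e \<sigma>)"
| "val (IsCell e) \<sigma> = Num (of_bool (is_cell (val e \<sigma>)))"
| "val (Add e f) \<sigma> = Num (the_num (val e \<sigma>) + the_num (val f \<sigma>))"
| "val (Sub e f) \<sigma> = Num (the_num (val e \<sigma>) - the_num (val f \<sigma>))"
| "val (Mul e f) \<sigma> = Num (the_num (val e \<sigma>) * the_num (val f \<sigma>))"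
| "val (Div e f) \<sigma> = Num (the_num (val e \<sigma>) div the_num (val f \<sigma>))"
| "val (Less e f) \<sigma> = Num (of_bool (the_num (val e \<sigma>) < the_num (val f \<sigma>)))"

fun subexps :: "exp \<Rightarrow> exp list" where
  "subexps (Var x) = []"
| "subexps (Lit i) = []"
| "subexps (Mk e f) = [e, f]"
| "subexps (Left e) = [e]"
| "subexps (Right e) = [e]"
| "subexps (IsCell e) = [e]"
| "subexps (Add e f) = [e, f]"
| "subexps (Sub e f) = [e, f]"
| "subexps (Mul e f) = [e, f]"
| "subexps (Div e f) = [e, f]"
| "subexps (Less e f) = [e, f]"

lemma size_subexps [termination_simp]: "f \<in> set (subexps e) \<Longrightarrow> size f < size e"
  by (cases e) auto

fun cost :: "exp \<Rightarrow> store \<Rightarrow> nat" where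
  "cost e \<sigma> = bit_size (val e \<sigma>) + (\<Sum>f\<leftarrow>subexps e. cost f \<sigma>)"

declare cost.simps [simp del]

datatype com =
    SKIP
  | Assign nat exp
  | Query nat exp
  | Seq com com
  | IF exp com com
  | WHILE exp com

text \<open>
  \<open>exec Orc c \<sigma> t \<tau>\<close>: with oracle \<open>Orc\<close>, the program \<open>c\<close> started in the store \<open>\<sigma>\<close> halts in the
  store \<open>\<tau>\<close> after time \<open>t\<close>.
\<close>

inductive exec :: "(data \<Rightarrow> bool) \<Rightarrow> com \<Rightarrow> store \<Rightarrow> nat \<Rightarrow> store \<Rightarrow> bool" for Orc where
  Skip: "exec Orc SKIP \<sigma> 1 \<sigma>"
| Assign: "exec Orc (Assign x e) \<sigma> (1 + cost e \<sigma>) (\<sigma>(x := val e \<sigma>))"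
| Query: "exec Orc (Query x e) \<sigma> (1 + cost e \<sigma>) (\<sigma>(x := Num (of_bool (Orc (val e \<sigma>)))))"
| Seq: "exec Orc c \<sigma> t \<sigma>' \<Longrightarrow> exec Orc d \<sigma>' u \<tau> \<Longrightarrow> exec Orc (Seq c d) \<sigma> (t + u) \<tau>"
| IfTrue: "val e \<sigma> \<noteq> Num 0 \<Longrightarrow> exec Orc c \<sigma> t \<tau> \<Longrightarrow> exec Orc (IF e c d) \<sigma> (1 + cost e \<sigma> + t) \<tau>"
| IfFalse: "val e \<sigma> = Num 0 \<Longrightarrow> exec Orc d \<sigma> t \<tau> \<Longrightarrow> exec Orc (IF e c d) \<sigma> (1 + cost e \<sigma> + t) \<tau>"
| WhileFalse: "val e \<sigma> = Num 0 \<Longrightarrow> exec Orc (WHILE e c) \<sigma> (1 + cost e \<sigma>) \<sigma>"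
| WhileTrue: "val e \<sigma> \<noteq> Num 0 \<Longrightarrow> exec Orc c \<sigma> t \<sigma>' \<Longrightarrow> exec Orc (WHILE e c) \<sigma>' u \<tau> \<Longrightarrow>
    exec Orc (WHILE e c) \<sigma> (1 + cost e \<sigma> + t + u) \<tau>"

lemma exec_deterministic:
  "exec Orc c \<sigma> t \<tau> \<Longrightarrow> exec Orc c \<sigma> t' \<tau>' \<Longrightarrow> t' = t \<and> \<tau>' = \<tau>"
proof (induction arbitrary: t' \<tau>' rule: exec.induct)
  case (Seq c \<sigma> t \<sigma>' d u \<tau>)
  from Seq.prems show ?case by cases (use Seq.IH in blast)
next
  case (WhileTrue e \<sigma> c t \<sigma>' u \<tau>)
  from WhileTrue.prems show ?case by cases (use WhileTrue.IH WhileTrue.hyps in blast)+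
qed (erule exec.cases; fastforce)+

fun query_free :: "com \<Rightarrow> bool" where
  "query_free SKIP = True"
| "query_free (Assign x e) = True"
| "query_free (Query x e) = False"
| "query_free (Seq c d) = (query_free c \<and> query_free d)"
| "query_free (IF e c d) = (query_free c \<and> query_free d)"
| "query_free (WHILE e c) = query_free c"

definition runs_within :: "(data \<Rightarrow> bool) \<Rightarrow> com \<Rightarrow> data \<Rightarrow> nat \<Rightarrow> data \<Rightarrow> bool" where
  "runs_within Orc c x b y \<longleftrightarrow>
    (\<exists>t \<tau>. exec Orc c ((\<lambda>_. Num 0)(0 := x)) t \<tau> \<and> t \<le> b \<and> \<tau> 0 = y)"

definition polytime_computable_on ::
  "'a set \<Rightarrow> ('a \<Rightarrow> data) \<Rightarrow> ('b \<Rightarrow> data) \<Rightarrow> ('a \<Rightarrow> 'b) \<Rightarrow> bool" where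
  "polytime_computable_on X enc enc' f \<longleftrightarrow>
    (\<exists>c (p :: nat poly). query_free c \<and>
      (\<forall>x\<in>X. runs_within (\<lambda>_. False) c (enc x) (poly p (bit_size (enc x))) (enc' (f x))))"

record 'a problem =
  instances :: "'a set"
  yes :: "'a \<Rightarrow> bool"
  encode :: "'a \<Rightarrow> data"

text \<open>
  Polynomial-time Turing reducibility of \<open>A\<close> to \<open>B\<close>, where on input \<open>x\<close> the oracle may only be
  consulted on instances \<open>y\<close> of \<open>B\<close> with \<open>allowed x y\<close>: its answers to all other queries are
  arbitrary. Every query takes time at least 1, so there are polynomially many of them.
\<close>

definition poly_turing_reducible ::
  "'a problem \<Rightarrow> 'b problem \<Rightarrow> ('a \<Rightarrow> 'b \<Rightarrow> bool) \<Rightarrow> bool" where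
  "poly_turing_reducible A B allowed \<longleftrightarrow>
    (\<exists>c (p :: nat poly). \<forall>x\<in>instances A. \<forall>Orc.
      (\<forall>y\<in>instances B. allowed x y \<longrightarrow> Orc (encode B y) = yes B y) \<longrightarrow>
      runs_within Orc c (encode A x) (poly p (bit_size (encode A x))) (Num (of_bool (yes A x))))"

section \<open>The decision problems\<close>

fun enc_list :: "('a \<Rightarrow> data) \<Rightarrow> 'a list \<Rightarrow> data" where
  "enc_list enc [] = Num 0"
| "enc_list enc (x # xs) = Cell (enc x) (enc_list enc xs)"

fun enc_base :: "base \<Rightarrow> data" where
  "enc_base Ade = Num 0"
| "enc_base Cyt = Num 1"
| "enc_base Gua = Num 2"
| "enc_base Thy = Num 3"

definition enc_rat :: "rat \<Rightarrow> data" where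
  "enc_rat r = Cell (Num (fst (quotient_of r))) (Num (snd (quotient_of r)))"

definition enc_strands :: "strand list \<Rightarrow> data" where
  "enc_strands = enc_list (enc_list enc_base)"

definition enc_input :: "('m \<Rightarrow> data) \<Rightarrow> strand list \<times> rat \<times> 'm \<Rightarrow> data" where
  "enc_input enc_model = (\<lambda>(s, T, M). Cell (enc_strands s) (Cell (enc_rat T) (enc_model M)))"

text \<open>
  \<open>\<Delta>G M\<close> is the energy function of the energy model \<open>M\<close>, \<open>enc_model M\<close> the description of \<open>M\<close> that
  occurs in inputs, and \<open>Inp\<close> the set of inputs \<open>(s, T, M)\<close> under consideration.
\<close>

definition dMFE ::
  "(strand list \<Rightarrow> sec_structure set) \<Rightarrow> ('m \<Rightarrow> energy) \<Rightarrow> ('m \<Rightarrow> data) \<Rightarrow>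
    (strand list \<times> rat \<times> 'm) set \<Rightarrow> (strand list \<times> rat \<times> 'm \<times> rat) problem" where
  "dMFE \<Omega> \<Delta>G enc_model Inp =
    \<lparr>instances = {(s, T, M, k). (s, T, M) \<in> Inp},
     yes = (\<lambda>(s, T, M, k). MFE \<Omega> (\<Delta>G M) s (of_rat T) \<le> of_rat k),
     encode = (\<lambda>(s, T, M, k). Cell (enc_input enc_model (s, T, M)) (enc_rat k))\<rparr>"

text \<open>The pair \<open>(M, \<alpha>)\<close> is the model \<open>M\<close> magnified by \<open>\<alpha>\<close>.\<close>

definition dPF ::
  "rat \<Rightarrow> (strand list \<Rightarrow> sec_structure set) \<Rightarrow> ('m \<Rightarrow> energy) \<Rightarrow> ('m \<Rightarrow> data) \<Rightarrow>
    (strand list \<times> rat \<times> 'm) set \<Rightarrow> (strand list \<times> rat \<times> ('m \<times> rat) \<times> rat) problem" where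
  "dPF kB \<Omega> \<Delta>G enc_model Inp =
    \<lparr>instances = {(s, T, (M, \<alpha>), k). (s, T, M) \<in> Inp \<and> \<alpha> > 0},
     yes = (\<lambda>(s, T, (M, \<alpha>), k).
       PF (of_rat kB) \<Omega> (magnify (of_rat \<alpha>) (\<Delta>G M)) s (of_rat T) \<ge> of_rat k),
     encode = (\<lambda>(s, T, M', k).
       Cell (enc_input (\<lambda>(M, \<alpha>). Cell (enc_model M) (enc_rat \<alpha>)) (s, T, M')) (enc_rat k))\<rparr>"

definition digits :: "rat \<Rightarrow> nat" where
  "digits r = floorlog 2 (nat \<bar>fst (quotient_of r)\<bar>) + floorlog 2 (nat (snd (quotient_of r)))"

text \<open>The logarithm is taken of \<open>n + 2\<close> instead of \<open>n\<close> so that it is at least 1 for all \<open>n\<close>.\<close>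

definition candidate_levels ::
  "(strand list \<Rightarrow> sec_structure set) \<Rightarrow> ('m \<Rightarrow> energy) \<Rightarrow> ('m \<Rightarrow> data) \<Rightarrow>
    (strand list \<times> rat \<times> 'm) set \<Rightarrow> (strand list \<times> rat \<times> 'm \<Rightarrow> rat list) \<Rightarrow> bool" where
  "candidate_levels \<Omega> \<Delta>G enc_model Inp lev \<longleftrightarrow>
    (\<forall>(s, T, M)\<in>Inp. \<Delta>G M s (of_rat T) ` \<Omega> s \<subseteq> of_rat ` set (lev (s, T, M))) \<and>
    (\<exists>p :: nat poly. \<forall>(s, T, M)\<in>Inp. card (set (lev (s, T, M))) \<le> poly p (num_bases s)) \<and>
    polytime_computable_on Inp (enc_input enc_model) (enc_list enc_rat) lev \<and>
    (\<exists>c :: real. \<forall>(s, T, M)\<in>Inp. \<forall>r\<in>set (lev (s, T, M)).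
      real (digits r) \<le> c * log 2 (real (num_bases s) + 2))"

end

theory Submission
  imports Defs
begin

text \<open>
  Put \<open>\<theta> = k\<^sub>B T\<close> and let \<open>r\<close> be a candidate level. Distinct candidate levels differ by at least
  \<open>1 / D\<^sup>2\<close>, where \<open>D\<close> is polynomial in \<open>n\<close>, and there are at most \<open>2\<close> to the power \<open>n\<^sup>2\<close> structures. Magnify by
  an \<open>\<alpha>\<close> with \<open>q \<le> \<alpha> / \<theta> \<le> 2 q\<close>, where \<open>q \<ge> (n\<^sup>2 + 3) D\<^sup>2\<close>. If \<open>MFE \<le> r\<close>, one structure already contributes
  \<open>exp (- \<alpha> r / \<theta>)\<close> to \<open>PF\<close>; otherwise every energy exceeds \<open>r\<close> by \<open>1 / D\<^sup>2\<close>, and all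
  structures together contribute less than \<open>exp (- \<alpha> r / \<theta> - 2)\<close>. With \<open>a = \<lceil>\<alpha> r / \<theta>\<rceil>\<close>, polynomially
  bounded in absolute value, and \<open>m = 2 a\<^sup>2 + 1\<close>, the rational number \<open>((m - a) / m) ^ m\<close> lies between
  \<open>exp (- a - 1)\<close> and \<open>exp (- a)\<close>, has polynomially many digits, and so serves as the query that
  decides \<open>MFE \<le> r\<close>. Finally, \<open>MFE\<close> is itself a candidate level, hence \<open>MFE \<le> k\<close> holds iff
  \<open>MFE \<le> r\<close> for some candidate level \<open>r \<le> k\<close>.
\<close>

section \<open>Bit sizes and running times\<close>

lemma floorlog_le_self: "floorlog 2 n \<le> n"
proof (cases "n = 0")
  case False
  then have "2 ^ (floorlog 2 n - 1) \<le> n" using floorlog_bounds[of n 2] by simp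
  moreover have "floorlog 2 n - 1 < 2 ^ (floorlog 2 n - 1)" by simp
  ultimately show ?thesis by linarith
qed (simp add: floorlog_def)

lemma less_power_floorlog: "n < 2 ^ floorlog 2 n"
  using floorlog_bounds[of n 2] by (cases "n = 0") (auto simp: floorlog_def)

lemma floorlog_add_le: "floorlog 2 (m + n) \<le> Suc (floorlog 2 m + floorlog 2 n)"
proof (rule floorlog_leI)
  from less_power_floorlog[of m] less_power_floorlog[of n]
  have "m + n < 2 ^ floorlog 2 m + 2 ^ floorlog 2 n" by linarith
  also have "\<dots> \<le> 2 ^ (floorlog 2 m + floorlog 2 n) + 2 ^ (floorlog 2 m + floorlog 2 n)"
    by (intro add_mono power_increasing) auto
  finally show "m + n < 2 ^ Suc (floorlog 2 m + floorlog 2 n)" by simp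
qed auto

lemma floorlog_mult_le: "floorlog 2 (m * n) \<le> floorlog 2 m + floorlog 2 n"
proof (rule floorlog_leI)
  show "m * n < 2 ^ (floorlog 2 m + floorlog 2 n)"
    unfolding power_add by (intro mult_strict_mono less_power_floorlog) auto
qed auto

lemma floorlog_power_le: "m \<le> y \<Longrightarrow> floorlog 2 (m ^ n) \<le> y * n + 1"
proof (rule floorlog_leI)
  assume "m \<le> y"
  then have "m \<le> 2 ^ y" using less_exp[of y] by linarith
  then have "m ^ n \<le> 2 ^ (y * n)" using power_mono[of m "2 ^ y" n] by (simp add: power_mult)
  also have "\<dots> < 2 ^ (y * n + 1)" by (intro power_strict_increasing) auto
  finally show "m ^ n < 2 ^ (y * n + 1)" .
qed auto

lemma bit_size_pos: "0 < bit_size d"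
  by (cases d) auto

lemma bit_size_Num_le: "bit_size (Num i) \<le> 1 + nat \<bar>i\<bar>"
  by (simp add: floorlog_le_self)

lemma bit_size_Num_mono: "\<bar>i\<bar> \<le> \<bar>j\<bar> \<Longrightarrow> bit_size (Num i) \<le> bit_size (Num j)"
  by (simp add: floorlog_mono nat_mono)

lemma bit_size_Num_power_le:
  assumes "\<bar>i\<bar> \<le> int y"
  shows "bit_size (Num (i ^ n)) \<le> y * n + 2"
proof -
  have "floorlog 2 (nat \<bar>i ^ n\<bar>) = floorlog 2 (nat \<bar>i\<bar> ^ n)"
    by (simp add: power_abs nat_power_eq)
  also have "\<dots> \<le> y * n + 1"
    using assms by (intro floorlog_power_le) auto
  finally show ?thesis by simp
qed

lemma bit_size_the_num_le: "floorlog 2 (nat \<bar>the_num d\<bar>) < bit_size d"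
  by (cases d) (auto simp: floorlog_def)

lemma bit_size_Num_add_le:
  "bit_size (Num (the_num a + the_num b)) \<le> bit_size a + bit_size b"
proof -
  have "floorlog 2 (nat \<bar>the_num a + the_num b\<bar>) \<le> floorlog 2 (nat \<bar>the_num a\<bar> + nat \<bar>the_num b\<bar>)"
    by (intro floorlog_mono) linarith
  then show ?thesis
    using floorlog_add_le[of "nat \<bar>the_num a\<bar>" "nat \<bar>the_num b\<bar>"]
      bit_size_the_num_le[of a] bit_size_the_num_le[of b] by simp
qed

lemma bit_size_Num_diff_le:
  "bit_size (Num (the_num a - the_num b)) \<le> bit_size a + bit_size b"
proof -
  have "floorlog 2 (nat \<bar>the_num a - the_num b\<bar>) \<le> floorlog 2 (nat \<bar>the_num a\<bar> + nat \<bar>the_num b\<bar>)"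
    by (intro floorlog_mono) linarith
  then show ?thesis
    using floorlog_add_le[of "nat \<bar>the_num a\<bar>" "nat \<bar>the_num b\<bar>"]
      bit_size_the_num_le[of a] bit_size_the_num_le[of b] by simp
qed

lemma bit_size_Num_mult_le:
  "bit_size (Num (the_num a * the_num b)) \<le> bit_size a + bit_size b"
  using floorlog_mult_le[of "nat \<bar>the_num a\<bar>" "nat \<bar>the_num b\<bar>"]
    bit_size_the_num_le[of a] bit_size_the_num_le[of b] by (simp add: abs_mult nat_mult_distrib)

lemma abs_div_le_abs: "\<bar>i div j\<bar> \<le> \<bar>i :: int\<bar>"
proof (cases "j = 0")
  case False
  have pos: "\<bar>i div j\<bar> \<le> \<bar>i\<bar>" if "j > 0" for i j :: int
  proof -
    have "\<bar>i\<bar> * 1 \<le> \<bar>i\<bar> * j" using that by (intro mult_left_mono) auto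
    then have "i \<le> \<bar>i\<bar> * j" by linarith
    then have "i div j \<le> \<bar>i\<bar>"
      using that by (metis nonzero_mult_div_cancel_right less_irrefl zdiv_mono1)
    moreover have "- \<bar>i\<bar> \<le> i div j"
    proof -
      have "- \<bar>i\<bar> * j \<le> - \<bar>i\<bar> * 1" using that by (intro mult_left_mono_neg) auto
      then have "- \<bar>i\<bar> * j \<le> i" by linarith
      then show ?thesis using that by (metis nonzero_mult_div_cancel_right less_irrefl zdiv_mono1)
    qed
    ultimately show ?thesis by linarith
  qed
  show ?thesis
    using pos[of j i] pos[of "- j" "- i"] False by (cases "j > 0") auto
qed auto

fun ecoef :: "exp \<Rightarrow> nat" where
  "ecoef e = (case e of Lit i \<Rightarrow> bit_size (Num i) | _ \<Rightarrow> 2) + 2 * (\<Sum>f\<leftarrow>subexps e. ecoef f)"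

declare ecoef.simps [simp del]

definition bounded_store :: "nat \<Rightarrow> store \<Rightarrow> bool" where
  "bounded_store S \<sigma> \<longleftrightarrow> (\<forall>v. bit_size (\<sigma> v) \<le> S)"

lemma bounded_store_upd:
  "bounded_store S \<sigma> \<Longrightarrow> bit_size d \<le> S \<Longrightarrow> bounded_store S (\<sigma>(x := d))"
  by (auto simp: bounded_store_def)

lemma bounded_store_mono: "bounded_store S \<sigma> \<Longrightarrow> S \<le> S' \<Longrightarrow> bounded_store S' \<sigma>"
  unfolding bounded_store_def by (meson le_trans)

lemma bit_size_val_le_cost: "bit_size (val e \<sigma>) \<le> cost e \<sigma>"
  by (subst cost.simps) simp

lemma bit_size_val_le:
  assumes "bounded_store S \<sigma>"
  shows "bit_size (val e \<sigma>) \<le>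
    (case e of Lit i \<Rightarrow> bit_size (Num i) | _ \<Rightarrow> 2) * (S + 1) + (\<Sum>f\<leftarrow>subexps e. bit_size (val f \<sigma>))"
proof (cases e)
  case (Var x)
  then show ?thesis using assms[unfolded bounded_store_def, rule_format, of x] by simp
next
  case (Left f)
  then show ?thesis by (cases "val f \<sigma>") (auto simp: floorlog_def)
next
  case (Right f)
  then show ?thesis by (cases "val f \<sigma>") (auto simp: floorlog_def)
next
  case (Div f g)
  then show ?thesis
    using bit_size_Num_mono[OF abs_div_le_abs, of "the_num (val f \<sigma>)" "the_num (val g \<sigma>)"]
      bit_size_the_num_le[of "val f \<sigma>"] by simp
next
  case (Add f g)
  then show ?thesis
    using bit_size_Num_add_le[of "val f \<sigma>" "val g \<sigma>"] by simp
next
  case (Sub f g)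
  then show ?thesis
    using bit_size_Num_diff_le[of "val f \<sigma>" "val g \<sigma>"] by simp
next
  case (Mul f g)
  then show ?thesis
    using bit_size_Num_mult_le[of "val f \<sigma>" "val g \<sigma>"] by simp
qed (auto simp: floorlog_def of_bool_def)

lemma cost_le:
  assumes "bounded_store S \<sigma>"
  shows "cost e \<sigma> \<le> ecoef e * (S + 1)"
proof (induction e rule: ecoef.induct)
  case (1 e)
  let ?c = "case e of Lit i \<Rightarrow> bit_size (Num i) | _ \<Rightarrow> 2"
  have "cost e \<sigma> \<le> ?c * (S + 1) + (\<Sum>f\<leftarrow>subexps e. bit_size (val f \<sigma>)) + (\<Sum>f\<leftarrow>subexps e. cost f \<sigma>)"
    using bit_size_val_le[OF assms, of e] by (subst cost.simps) simp
  also have "(\<Sum>f\<leftarrow>subexps e. bit_size (val f \<sigma>)) \<le> (\<Sum>f\<leftarrow>subexps e. cost f \<sigma>)"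
    by (intro sum_list_mono bit_size_val_le_cost)
  also have "(\<Sum>f\<leftarrow>subexps e. cost f \<sigma>) \<le> (\<Sum>f\<leftarrow>subexps e. ecoef f * (S + 1))"
    using 1 by (intro sum_list_mono) auto
  also have "\<dots> = (\<Sum>f\<leftarrow>subexps e. ecoef f) * (S + 1)"
    by (rule sum_list_mult_const)
  finally show ?case
    by (subst ecoef.simps) (simp add: algebra_simps)
qed

fun ccoef :: "com \<Rightarrow> nat" where
  "ccoef SKIP = 1"
| "ccoef (Assign x e) = 1 + ecoef e"
| "ccoef (Query x e) = 1 + ecoef e"
| "ccoef (Seq c d) = ccoef c + ccoef d"
| "ccoef (IF e c d) = 1 + ecoef e + ccoef c + ccoef d"
| "ccoef (WHILE e c) = 1 + ecoef e + ccoef c"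

text \<open>
  Every run is accounted as a multiple of the static weight \<open>ccoef c\<close>, so that sequencing adds
  weights while the bound \<open>B\<close> stays the same.
\<close>

definition run :: "(data \<Rightarrow> bool) \<Rightarrow> com \<Rightarrow> store \<Rightarrow> nat \<Rightarrow> store \<Rightarrow> bool" where
  "run Orc c \<sigma> B \<tau> \<longleftrightarrow> (\<exists>t\<le>ccoef c * B. exec Orc c \<sigma> t \<tau>)"

lemma ccoef_pos: "1 \<le> ccoef c"
  by (induction c) auto

lemma run_mono: "run Orc c \<sigma> B \<tau> \<Longrightarrow> B \<le> B' \<Longrightarrow> run Orc c \<sigma> B' \<tau>"
  unfolding run_def using mult_le_mono2 le_trans by blast

lemma exec_imp_run: "exec Orc c \<sigma> t \<tau> \<Longrightarrow> t \<le> B \<Longrightarrow> run Orc c \<sigma> B \<tau>"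
  unfolding run_def using ccoef_pos[of c] mult_le_mono[of 1 "ccoef c" t B] by auto

lemma one_plus_cost_le:
  assumes "bounded_store S \<sigma>" "S < B"
  shows "1 + cost e \<sigma> \<le> (1 + ecoef e) * B"
proof -
  have "cost e \<sigma> \<le> ecoef e * (S + 1)" by (rule cost_le[OF assms(1)])
  also have "\<dots> \<le> ecoef e * B" using assms(2) by (intro mult_le_mono2) simp
  finally show ?thesis using assms(2) by simp
qed

lemma run_Assign:
  assumes "bounded_store S \<sigma>" "S < B"
  shows "run Orc (Assign x e) \<sigma> B (\<sigma>(x := val e \<sigma>))"
  unfolding run_def using exec.Assign[of Orc x e \<sigma>] one_plus_cost_le[OF assms, of e]
  by (intro exI[of _ "1 + cost e \<sigma>"]) simp

lemma run_Query:
  assumes "bounded_store S \<sigma>" "S < B"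
  shows "run Orc (Query x e) \<sigma> B (\<sigma>(x := Num (of_bool (Orc (val e \<sigma>)))))"
  unfolding run_def using exec.Query[of Orc x e \<sigma>] one_plus_cost_le[OF assms, of e]
  by (intro exI[of _ "1 + cost e \<sigma>"]) simp

lemma run_Seq:
  assumes "run Orc c \<sigma> B \<rho>" "run Orc d \<rho> B \<tau>"
  shows "run Orc (Seq c d) \<sigma> B \<tau>"
proof -
  obtain t u where "t \<le> ccoef c * B" "exec Orc c \<sigma> t \<rho>" "u \<le> ccoef d * B" "exec Orc d \<rho> u \<tau>"
    using assms by (auto simp: run_def)
  then show ?thesis
    unfolding run_def by (intro exI[of _ "t + u"]) (auto simp: algebra_simps intro: exec.Seq)
qed

lemma run_IF:
  assumes "bounded_store S \<sigma>" "S < B" "run Orc (if val e \<sigma> \<noteq> Num 0 then c else d) \<sigma> B \<tau>"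
  shows "run Orc (IF e c d) \<sigma> B \<tau>"
proof -
  obtain t where t: "t \<le> ccoef (if val e \<sigma> \<noteq> Num 0 then c else d) * B"
    "exec Orc (if val e \<sigma> \<noteq> Num 0 then c else d) \<sigma> t \<tau>"
    using assms(3) by (auto simp: run_def)
  have "t \<le> ccoef c * B + ccoef d * B" using t(1) by (auto split: if_splits)
  moreover have "exec Orc (IF e c d) \<sigma> (1 + cost e \<sigma> + t) \<tau>"
    using t(2) exec.IfTrue[of e \<sigma> Orc c t \<tau> d] exec.IfFalse[of e \<sigma> Orc d t \<tau> c]
    by (auto split: if_splits)
  ultimately show ?thesis
    unfolding run_def using one_plus_cost_le[OF assms(1,2), of e]
    by (intro exI[of _ "1 + cost e \<sigma> + t"]) (auto simp: algebra_simps)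
qed

lemma run_WHILE_stop:
  assumes "bounded_store S \<sigma>" "S < B" "val e \<sigma> = Num 0"
  shows "run Orc (WHILE e c) \<sigma> B \<sigma>"
  unfolding run_def using exec.WhileFalse[OF assms(3), of Orc c] one_plus_cost_le[OF assms(1,2), of e]
  by (intro exI[of _ "1 + cost e \<sigma>"]) (auto simp: algebra_simps)

lemma run_WHILE_step:
  assumes "bounded_store S \<sigma>" "S < B" "val e \<sigma> \<noteq> Num 0"
    and "run Orc c \<sigma> B \<rho>" "run Orc (WHILE e c) \<rho> (n * B) \<tau>"
  shows "run Orc (WHILE e c) \<sigma> (Suc n * B) \<tau>"
proof -
  obtain t u where "t \<le> ccoef c * B" "exec Orc c \<sigma> t \<rho>"
    "u \<le> ccoef (WHILE e c) * (n * B)" "exec Orc (WHILE e c) \<rho> u \<tau>"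
    using assms(4,5) by (auto simp: run_def)
  then show ?thesis
    unfolding run_def using exec.WhileTrue[of e \<sigma> Orc c t \<rho> u \<tau>] assms(3)
      one_plus_cost_le[OF assms(1,2), of e]
    by (intro exI[of _ "1 + cost e \<sigma> + t + u"]) (auto simp: algebra_simps)
qed

lemma exec_bit_size_le: "exec Orc c \<sigma> t \<tau> \<Longrightarrow> bit_size (\<tau> v) \<le> bit_size (\<sigma> v) + t"
proof (induction rule: exec.induct)
  case (Assign x e \<sigma>)
  then show ?case using bit_size_val_le_cost[of e \<sigma>] by auto
next
  case (Query x e \<sigma>)
  have "1 \<le> cost e \<sigma>" using bit_size_val_le_cost[of e \<sigma>] bit_size_pos[of "val e \<sigma>"] by linarith
  then show ?case by (auto simp: floorlog_def of_bool_def)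
qed auto

fun evars :: "exp \<Rightarrow> nat set" where
  "evars (Var x) = {x}"
| "evars e = (\<Union>f\<in>set (subexps e). evars f)"

fun cvars :: "com \<Rightarrow> nat set" where
  "cvars SKIP = {}"
| "cvars (Assign x e) = insert x (evars e)"
| "cvars (Query x e) = insert x (evars e)"
| "cvars (Seq c d) = cvars c \<union> cvars d"
| "cvars (IF e c d) = evars e \<union> cvars c \<union> cvars d"
| "cvars (WHILE e c) = evars e \<union> cvars c"

lemma finite_evars: "finite (evars e)"
  by (induction e) auto

lemma finite_cvars: "finite (cvars c)"
  by (induction c) (auto simp: finite_evars)

lemma val_cong: "(\<And>v. v \<in> evars e \<Longrightarrow> \<sigma> v = \<tau> v) \<Longrightarrow> val e \<sigma> = val e \<tau>"
  by (induction e) auto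

lemma evars_subexps: "f \<in> set (subexps e) \<Longrightarrow> evars f \<subseteq> evars e"
  by (cases e) auto

lemma cost_cong: "(\<And>v. v \<in> evars e \<Longrightarrow> \<sigma> v = \<tau> v) \<Longrightarrow> cost e \<sigma> = cost e \<tau>"
proof (induction e rule: ecoef.induct)
  case (1 e)
  have "map (\<lambda>f. cost f \<sigma>) (subexps e) = map (\<lambda>f. cost f \<tau>) (subexps e)"
    using 1 evars_subexps by (intro map_cong) blast+
  then show ?case
    using val_cong[of e \<sigma> \<tau>] 1(2) unfolding cost.simps[of e] by metis
qed

lemma exec_query_free_frame:
  assumes "exec Orc c \<sigma> t \<tau>" "query_free c" "cvars c \<subseteq> V"
    and "\<And>v. v \<in> V \<Longrightarrow> \<sigma>' v = \<sigma> v"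
  shows "exec Orc' c \<sigma>' t (\<lambda>v. if v \<in> V then \<tau> v else \<sigma>' v)"
  using assms
proof (induction arbitrary: \<sigma>' rule: exec.induct)
  case (Skip \<sigma>)
  then have "(\<lambda>v. if v \<in> V then \<sigma> v else \<sigma>' v) = \<sigma>'" by auto
  then show ?case using exec.Skip by metis
next
  case (Assign x e \<sigma>)
  then have "val e \<sigma>' = val e \<sigma>" "cost e \<sigma>' = cost e \<sigma>"
    by (auto intro!: val_cong cost_cong)
  moreover have "(\<lambda>v. if v \<in> V then (\<sigma>(x := val e \<sigma>)) v else \<sigma>' v) = \<sigma>'(x := val e \<sigma>)"
    using Assign by auto
  ultimately show ?case using exec.Assign[of Orc' x e \<sigma>'] by simp
next
  case (Query x e \<sigma>)
  then show ?case by simp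
next
  case (Seq c \<sigma> t \<rho> d u \<tau>)
  have "exec Orc' c \<sigma>' t (\<lambda>v. if v \<in> V then \<rho> v else \<sigma>' v)" using Seq by auto
  moreover have "exec Orc' d (\<lambda>v. if v \<in> V then \<rho> v else \<sigma>' v) u
      (\<lambda>v. if v \<in> V then \<tau> v else (if v \<in> V then \<rho> v else \<sigma>' v))"
    using Seq by (intro Seq.IH(2)) auto
  ultimately show ?case by (auto dest: exec.Seq cong: if_cong)
next
  case (IfTrue e \<sigma> c t \<tau> d)
  from IfTrue.prems have "val e \<sigma>' = val e \<sigma>" "cost e \<sigma>' = cost e \<sigma>"
    by (auto intro!: val_cong cost_cong)
  then show ?case using exec.IfTrue[of e \<sigma>' Orc' c t _ d] IfTrue by auto
next
  case (IfFalse e \<sigma> d t \<tau> c)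
  from IfFalse.prems have "val e \<sigma>' = val e \<sigma>" "cost e \<sigma>' = cost e \<sigma>"
    by (auto intro!: val_cong cost_cong)
  moreover have "exec Orc' d \<sigma>' t (\<lambda>v. if v \<in> V then \<tau> v else \<sigma>' v)" using IfFalse by auto
  ultimately show ?case using exec.IfFalse[of e \<sigma>' Orc' d t _ c] IfFalse.hyps(1) by metis
next
  case (WhileFalse e \<sigma> c)
  from WhileFalse.prems have "val e \<sigma>' = val e \<sigma>" "cost e \<sigma>' = cost e \<sigma>"
    by (auto intro!: val_cong cost_cong)
  moreover have "(\<lambda>v. if v \<in> V then \<sigma> v else \<sigma>' v) = \<sigma>'" using WhileFalse by auto
  ultimately show ?case using exec.WhileFalse[of e \<sigma>' Orc' c] WhileFalse by simp
next
  case (WhileTrue e \<sigma> c t \<rho> u \<tau>)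
  from WhileTrue.prems have "val e \<sigma>' = val e \<sigma>" "cost e \<sigma>' = cost e \<sigma>"
    by (auto intro!: val_cong cost_cong)
  moreover have "exec Orc' c \<sigma>' t (\<lambda>v. if v \<in> V then \<rho> v else \<sigma>' v)" using WhileTrue by auto
  moreover have "exec Orc' (WHILE e c) (\<lambda>v. if v \<in> V then \<rho> v else \<sigma>' v) u
      (\<lambda>v. if v \<in> V then \<tau> v else (if v \<in> V then \<rho> v else \<sigma>' v))"
    using WhileTrue by (intro WhileTrue.IH(2)) auto
  moreover have "(\<lambda>v. if v \<in> V then \<tau> v else (if v \<in> V then \<rho> v else \<sigma>' v)) =
    (\<lambda>v. if v \<in> V then \<tau> v else \<sigma>' v)" by auto
  ultimately show ?case using exec.WhileTrue[of e \<sigma>' Orc' c t _ u] WhileTrue.hyps(1) by metis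
qed

section \<open>Thresholds for the partition function\<close>

lemma quotient_of_ratio:
  assumes "0 < d" "coprime n d"
  shows "quotient_of (of_int n / of_int d) = (n, d)"
  using assms by (simp add: Fract_of_int_quotient[symmetric] quotient_of_Fract)

lemma quotient_of_imp_eq: "quotient_of r = (p, d) \<Longrightarrow> r = of_int p / of_int d \<and> 0 < d"
  by (simp add: quotient_of_denom_pos quotient_of_div)

text \<open>
  Numerator or denominator is 1, so this fraction is in lowest terms and its encoding needs no
  gcd computation. The same holds for \<open>threshold\<close> below, as \<open>2 a\<^sup>2 + 1\<close> is coprime to \<open>a\<close>.
\<close>

definition magnification :: "rat \<Rightarrow> nat \<Rightarrow> rat" where
  "magnification \<theta> q = of_int \<lceil>of_nat q * \<theta>\<rceil> / of_int (max 1 \<lfloor>1 / (of_nat q * \<theta>)\<rfloor>)"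

lemma magnification_cases:
  assumes "\<theta> > 0" "q > 0"
  obtains "of_nat q * \<theta> \<ge> 1" "max 1 \<lfloor>1 / (of_nat q * \<theta>)\<rfloor> = 1" "1 \<le> \<lceil>of_nat q * \<theta>\<rceil>"
  | "of_nat q * \<theta> < 1" "\<lceil>of_nat q * \<theta>\<rceil> = 1" "1 \<le> \<lfloor>1 / (of_nat q * \<theta>)\<rfloor>"
proof (cases "of_nat q * \<theta> \<ge> 1")
  case True
  then have "1 / (of_nat q * \<theta>) \<le> 1" using assms by simp
  then have "\<lfloor>1 / (of_nat q * \<theta>)\<rfloor> \<le> 1" using floor_mono by fastforce
  then show ?thesis using that(1) True by (simp add: one_le_ceiling)
next
  case False
  have "0 < of_nat q * \<theta>" using assms by simp
  then have "1 \<le> 1 / (of_nat q * \<theta>)" using False by simp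
  then show ?thesis using that(2) False \<open>0 < of_nat q * \<theta>\<close> by (simp add: ceiling_eq_iff)
qed

lemma quotient_of_magnification:
  assumes "\<theta> > 0" "q > 0"
  shows "quotient_of (magnification \<theta> q) =
    (\<lceil>of_nat q * \<theta>\<rceil>, max 1 \<lfloor>1 / (of_nat q * \<theta>)\<rfloor>)"
  unfolding magnification_def
  by (rule quotient_of_ratio; rule magnification_cases[OF assms]) auto

lemma magnification_pos:
  assumes "\<theta> > 0" "q > 0"
  shows "magnification \<theta> q > 0"
  unfolding magnification_def
  by (rule magnification_cases[OF assms]) (auto intro!: divide_pos_pos)

lemma magnification_bounds:
  assumes "\<theta> > 0" "q > 0"
  shows "of_nat q \<le> magnification \<theta> q / \<theta>" "magnification \<theta> q / \<theta> \<le> 2 * of_nat q"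
proof -
  define z where "z = of_nat q * \<theta>"
  have z: "0 < z" using assms by (simp add: z_def)
  have "z \<le> magnification \<theta> q \<and> magnification \<theta> q \<le> 2 * z"
    using assms
  proof (cases rule: magnification_cases)
    case 1
    then have "magnification \<theta> q = of_int \<lceil>z\<rceil>" by (simp add: magnification_def z_def)
    then show ?thesis using 1(1) ceiling_correct[of z] by (auto simp: z_def)
  next
    case 2
    define f where "f = \<lfloor>1 / z\<rfloor>"
    have eq: "magnification \<theta> q = 1 / of_int f" using 2 by (simp add: magnification_def z_def f_def)
    have f1: "1 \<le> f" using 2 by (simp add: f_def z_def)
    have "of_int f \<le> 1 / z" "1 / z < of_int f + 1" unfolding f_def by linarith+
    then have "of_int f * z \<le> 1" "1 \<le> (of_int f + 1) * z"
      using z by (auto simp: field_simps)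
    moreover have "(of_int f + 1) * z \<le> (2 * of_int f) * z"
      using f1 z by (intro mult_right_mono) auto
    ultimately have "1 \<le> (2 * of_int f) * z" by linarith
    then show ?thesis using f1 z \<open>of_int f * z \<le> 1\<close> unfolding eq by (auto simp: field_simps)
  qed
  then show "of_nat q \<le> magnification \<theta> q / \<theta>" "magnification \<theta> q / \<theta> \<le> 2 * of_nat q"
    using assms by (auto simp: z_def field_simps)
qed

definition exponent :: "int \<Rightarrow> int" where
  "exponent a = 2 * a\<^sup>2 + 1"

definition threshold :: "int \<Rightarrow> rat" where
  "threshold a = (of_int (exponent a - a) / of_int (exponent a)) ^ nat (exponent a)"

lemma exponent_pos: "0 < exponent a"
  by (simp add: exponent_def add_nonneg_pos)

lemma abs_le_square_int: "\<bar>a :: int\<bar> \<le> a\<^sup>2"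
proof (cases "a = 0")
  case False
  then have "\<bar>a\<bar> * 1 \<le> \<bar>a\<bar> * \<bar>a\<bar>" by (intro mult_left_mono) auto
  then show ?thesis by (simp add: power2_eq_square)
qed simp

lemma quotient_of_threshold:
  "quotient_of (threshold a) =
    ((exponent a - a) ^ nat (exponent a), exponent a ^ nat (exponent a))"
proof -
  have "exponent a + a * (- 2 * a) = 1" by (simp add: exponent_def power2_eq_square)
  then have "coprime a (exponent a)"
    by (metis coprimeI dvd_add dvd_mult2)
  then have "coprime (exponent a - a) (exponent a)"
  proof (intro coprimeI)
    fix c assume coprime: "coprime a (exponent a)" and c: "c dvd exponent a - a" "c dvd exponent a"
    have "c dvd exponent a - (exponent a - a)" using dvd_diff[OF c(2) c(1)] .
    then show "is_unit c" using coprime_common_divisor[OF coprime _ c(2)] by simp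
  qed
  then show ?thesis
    unfolding threshold_def power_divide of_int_power[symmetric]
    using exponent_pos by (intro quotient_of_ratio) auto
qed

lemma threshold_bounds:
  "exp (- real_of_int a - 1) \<le> real_of_rat (threshold a)"
  "real_of_rat (threshold a) \<le> exp (- real_of_int a)"
proof -
  define m where "m = real_of_int (exponent a)"
  have m: "m > 0" using exponent_pos by (simp add: m_def)
  have m_eq: "m = 2 * (real_of_int a)\<^sup>2 + 1" by (simp add: m_def exponent_def)
  define x where "x = - real_of_int a / m"
  have "2 * \<bar>a\<bar> \<le> exponent a" using abs_le_square_int[of a] by (simp add: exponent_def)
  then have "2 * \<bar>real_of_int a\<bar> \<le> m" unfolding m_def by linarith
  then have x: "\<bar>x\<bar> \<le> 1/2" using m by (simp add: x_def field_simps)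
  have mx: "m * x = - real_of_int a" using m by (simp add: x_def)
  have "real_of_rat (threshold a) = (1 + x) ^ nat (exponent a)"
    using m by (simp add: threshold_def of_rat_power of_rat_divide of_rat_diff x_def m_def diff_divide_distrib)
  also have "\<dots> = exp (real (nat (exponent a)) * ln (1 + x))"
    using x by (subst exp_of_nat_mult) (simp add: exp_ln)
  also have "real (nat (exponent a)) = m" using exponent_pos[of a] by (simp add: m_def)
  finally have eq: "real_of_rat (threshold a) = exp (m * ln (1 + x))" .
  have "m * ln (1 + x) \<le> m * x"
    using x m by (intro mult_left_mono ln_add_one_self_le_self2) auto
  then show "real_of_rat (threshold a) \<le> exp (- real_of_int a)" using eq mx by simp
  have "x - 2 * x\<^sup>2 \<le> ln (1 + x)"
    using abs_ln_one_plus_x_minus_x_bound[OF x] by (simp add: abs_le_iff)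
  then have "m * (x - 2 * x\<^sup>2) \<le> m * ln (1 + x)" using m by (intro mult_left_mono) auto
  moreover have "m * (2 * x\<^sup>2) \<le> 1"
  proof -
    have "m * (2 * x\<^sup>2) = 2 * (real_of_int a)\<^sup>2 / m"
      using m by (simp add: x_def power2_eq_square field_simps)
    also have "\<dots> \<le> 1" using m m_eq by (simp add: field_simps)
    finally show ?thesis .
  qed
  ultimately have "- real_of_int a - 1 \<le> m * ln (1 + x)"
    using mx by (simp add: algebra_simps)
  then show "exp (- real_of_int a - 1) \<le> real_of_rat (threshold a)" using eq by simp
qed

lemma finite_sites: "finite (sites s)" and card_sites: "card (sites s) = num_bases s"
proof -
  have eq: "sites s = (SIGMA i : {..<length s}. {..<length (s ! i)})"
    by (auto simp: sites_def)
  show "finite (sites s)" unfolding eq by auto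
  show "card (sites s) = num_bases s"
    unfolding eq num_bases_def by (simp add: sum_list_sum_nth atLeast0LessThan)
qed

lemma finite_base_pairs: "finite (base_pairs s)"
  and card_base_pairs: "card (base_pairs s) \<le> (num_bases s)\<^sup>2"
proof -
  have sub: "base_pairs s \<subseteq> (\<lambda>(x, y). {x, y}) ` (sites s \<times> sites s)"
    by (auto simp: base_pairs_def)
  then show "finite (base_pairs s)" using finite_sites finite_subset by blast
  have "card (base_pairs s) \<le> card ((\<lambda>(x, y). {x, y}) ` (sites s \<times> sites s))"
    using sub finite_sites by (intro card_mono) auto
  also have "\<dots> \<le> card (sites s \<times> sites s)"
    using finite_sites by (intro card_image_le) auto
  finally show "card (base_pairs s) \<le> (num_bases s)\<^sup>2"
    by (simp add: card_cartesian_product card_sites power2_eq_square)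
qed

lemma finite_secondary_structures: "finite (secondary_structures s)"
  and card_secondary_structures: "card (secondary_structures s) \<le> 2 ^ (num_bases s)\<^sup>2"
proof -
  have sub: "secondary_structures s \<subseteq> Pow (base_pairs s)"
    by (auto simp: secondary_structures_def)
  then show "finite (secondary_structures s)"
    using finite_base_pairs finite_subset by blast
  have "card (secondary_structures s) \<le> card (Pow (base_pairs s))"
    using sub finite_base_pairs by (intro card_mono) auto
  also have "\<dots> \<le> 2 ^ (num_bases s)\<^sup>2"
    using card_base_pairs by (simp add: card_Pow finite_base_pairs)
  finally show "card (secondary_structures s) \<le> 2 ^ (num_bases s)\<^sup>2" .
qed

lemma rat_gap:
  fixes r r' :: rat
  assumes "r < r'" "snd (quotient_of r) \<le> int D" "snd (quotient_of r') \<le> int D"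
  shows "1 \<le> of_nat (D\<^sup>2) * (r' - r)"
proof -
  obtain p d where r: "quotient_of r = (p, d)" by force
  obtain p' d' where r': "quotient_of r' = (p', d')" by force
  have d: "r = of_int p / of_int d" "0 < d" and d': "r' = of_int p' / of_int d'" "0 < d'"
    using quotient_of_imp_eq r r' by blast+
  have "of_int (p * d') < (of_int (p' * d) :: rat)"
    using assms(1) d d' by (simp add: field_simps)
  then have "1 \<le> p' * d - p * d'" by (simp only: of_int_less_iff)
  then have "1 \<le> (of_int (p' * d - p * d') :: rat)" by (metis of_int_1 of_int_le_iff)
  also have "\<dots> = of_int (d * d') * (r' - r)"
    using d d' by (simp add: field_simps)
  also have "\<dots> \<le> of_nat (D\<^sup>2) * (r' - r)"
  proof (intro mult_right_mono)
    have "d * d' \<le> int D * int D" using assms(2,3) d d' r r' by (intro mult_mono) auto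
    then show "of_int (d * d') \<le> (of_nat (D\<^sup>2) :: rat)"
      by (metis of_int_le_iff of_int_of_nat_eq of_nat_mult power2_eq_square)
  qed (use assms in auto)
  finally show ?thesis .
qed

lemma abs_rat_le_num: "\<bar>r :: rat\<bar> \<le> of_int \<bar>fst (quotient_of r)\<bar>"
proof -
  obtain p d where r: "quotient_of r = (p, d)" by force
  have d: "r = of_int p / of_int d" "1 \<le> d"
    using quotient_of_imp_eq[OF r] by auto
  then have "\<bar>r\<bar> = of_int \<bar>p\<bar> / of_int d" by simp
  also have "\<dots> \<le> of_int \<bar>p\<bar> / 1" using d(2) by (intro divide_left_mono) auto
  finally show ?thesis using r by simp
qed

lemma threshold_le_PF_iff:
  fixes kB T r :: rat
  assumes pos: "kB > 0" "T > 0"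
    and \<Omega>: "\<Omega> s \<noteq> {}" "\<Omega> s \<subseteq> secondary_structures s"
    and lev: "E s (of_rat T) ` \<Omega> s \<subseteq> of_rat ` L" "r \<in> L"
    and den: "\<And>r. r \<in> L \<Longrightarrow> snd (quotient_of r) \<le> int D"
    and q: "((num_bases s)\<^sup>2 + 3) * D\<^sup>2 \<le> q" "0 < q"
  defines "\<alpha> \<equiv> magnification (kB * T) q"
  shows "of_rat (threshold \<lceil>\<alpha> / (kB * T) * r\<rceil>) \<le> PF (of_rat kB) \<Omega> (magnify (of_rat \<alpha>) E) s (of_rat T)
    \<longleftrightarrow> MFE \<Omega> E s (of_rat T) \<le> of_rat r"
proof -
  define a where "a = \<lceil>\<alpha> / (kB * T) * r\<rceil>"
  define \<gamma> where "\<gamma> = \<alpha> / (kB * T)"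
  have g: "of_nat q \<le> \<gamma>" "0 < \<gamma>"
    using magnification_bounds(1)[of "kB * T" q] pos q(2) magnification_pos[of "kB * T" q]
    by (auto simp: \<gamma>_def \<alpha>_def)
  have fin: "finite (\<Omega> s)"
    using \<Omega>(2) finite_secondary_structures finite_subset by blast
  have PF: "PF (of_rat kB) \<Omega> (magnify (of_rat \<alpha>) E) s (of_rat T) =
      (\<Sum>S\<in>\<Omega> s. exp (- (of_rat \<gamma> * E s (of_rat T) S)))"
    unfolding PF_def magnify_def \<gamma>_def by (simp add: of_rat_divide of_rat_mult)
  have a: "\<gamma> * r \<le> of_int a" "of_int a < \<gamma> * r + 1"
    unfolding a_def \<gamma>_def by linarith+
  have a': "of_rat \<gamma> * of_rat r \<le> real_of_int a" "real_of_int a < of_rat \<gamma> * of_rat r + 1"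
    unfolding of_rat_mult[symmetric]
    using of_rat_less_eq[of "\<gamma> * r" "of_int a", where 'a = real] a(1)
      of_rat_less[of "of_int a" "\<gamma> * r + 1", where 'a = real] a(2)
    by (simp_all add: of_rat_add)
  show ?thesis
    unfolding PF a_def[symmetric]
  proof
    assume "MFE \<Omega> E s (of_rat T) \<le> of_rat r"
    then obtain S where S: "S \<in> \<Omega> s" "E s (of_rat T) S \<le> of_rat r"
      unfolding MFE_def using fin \<Omega>(1) by (subst (asm) Min_le_iff) auto
    have "of_rat (threshold a) \<le> exp (- real_of_int a)" by (rule threshold_bounds)
    also have "\<dots> \<le> exp (- (of_rat \<gamma> * of_rat r))" using a' by simp
    also have "\<dots> \<le> exp (- (of_rat \<gamma> * E s (of_rat T) S))"
      using g S by (simp add: mult_left_mono)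
    also have "\<dots> \<le> (\<Sum>S\<in>\<Omega> s. exp (- (of_rat \<gamma> * E s (of_rat T) S)))"
      using S fin by (intro member_le_sum) auto
    finally show "of_rat (threshold a) \<le> (\<Sum>S\<in>\<Omega> s. exp (- (of_rat \<gamma> * E s (of_rat T) S)))" .
  next
    assume le: "of_rat (threshold a) \<le> (\<Sum>S\<in>\<Omega> s. exp (- (of_rat \<gamma> * E s (of_rat T) S)))"
    show "MFE \<Omega> E s (of_rat T) \<le> of_rat r"
    proof (rule ccontr)
      assume *: "\<not> ?thesis"
      let ?n = "real ((num_bases s)\<^sup>2)"
      have "exp (- (of_rat \<gamma> * E s (of_rat T) S)) \<le> exp (- real_of_int a - 2 - ?n)" if S: "S \<in> \<Omega> s" for S
      proof -
        obtain r' where r': "E s (of_rat T) S = of_rat r'" "r' \<in> L" using lev(1) S by blast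
        have "MFE \<Omega> E s (of_rat T) \<le> E s (of_rat T) S"
          unfolding MFE_def using S fin by (intro Min_le) auto
        with * r' have "(of_rat r :: real) < of_rat r'" by simp
        then have "r < r'" by (simp only: of_rat_less)
        have "of_nat ((num_bases s)\<^sup>2 + 3) * 1 \<le> (of_nat ((num_bases s)\<^sup>2 + 3) :: rat) * (of_nat (D\<^sup>2) * (r' - r))"
          using rat_gap[OF \<open>r < r'\<close> den[OF lev(2)] den[OF r'(2)]]
          by (intro mult_left_mono) auto
        also have "\<dots> = of_nat (((num_bases s)\<^sup>2 + 3) * D\<^sup>2) * (r' - r)" by (simp only: of_nat_mult mult.assoc)
        also have "\<dots> \<le> of_nat q * (r' - r)"
          using \<open>r < r'\<close> q(1) by (intro mult_right_mono) (auto simp only: of_nat_le_iff)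
        also have "\<dots> \<le> \<gamma> * (r' - r)" using \<open>r < r'\<close> g by (intro mult_right_mono) auto
        finally have "of_nat ((num_bases s)\<^sup>2 + 3) \<le> \<gamma> * (r' - r)" by simp
        then have "real ((num_bases s)\<^sup>2 + 3) \<le> of_rat (\<gamma> * (r' - r))"
          by (metis of_rat_less_eq of_rat_of_nat_eq)
        then have "?n + 3 \<le> of_rat \<gamma> * of_rat r' - of_rat \<gamma> * of_rat r"
          by (simp add: of_rat_mult of_rat_diff algebra_simps)
        then show ?thesis using a' r' by simp
      qed
      then have "(\<Sum>S\<in>\<Omega> s. exp (- (of_rat \<gamma> * E s (of_rat T) S))) \<le> real (card (\<Omega> s)) * exp (- real_of_int a - 2 - ?n)"
        by (intro sum_bounded_above)
      also have "\<dots> \<le> exp ?n * exp (- real_of_int a - 2 - ?n)"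
      proof (intro mult_right_mono)
        have "card (\<Omega> s) \<le> 2 ^ (num_bases s)\<^sup>2"
          using card_mono[OF finite_secondary_structures \<Omega>(2)] card_secondary_structures le_trans by blast
        then have "real (card (\<Omega> s)) \<le> 2 ^ (num_bases s)\<^sup>2"
          by (metis of_nat_le_iff of_nat_numeral of_nat_power)
        also have "\<dots> \<le> exp 1 ^ (num_bases s)\<^sup>2"
          using exp_ge_add_one_self[of 1] by (intro power_mono) auto
        also have "\<dots> = exp ?n" by (simp add: exp_of_nat_mult[symmetric])
        finally show "real (card (\<Omega> s)) \<le> exp ?n" .
      qed auto
      also have "\<dots> = exp (- real_of_int a - 2)" by (simp add: exp_add[symmetric])
      also have "\<dots> < exp (- real_of_int a - 1)" by simp
      also have "\<dots> \<le> of_rat (threshold a)" by (rule threshold_bounds)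
      finally show False using le by simp
    qed
  qed
qed

lemma MFE_le_iff:
  assumes "finite (\<Omega> s)" "\<Omega> s \<noteq> {}" "E s (of_rat T) ` \<Omega> s \<subseteq> of_rat ` L"
  shows "MFE \<Omega> E s (of_rat T) \<le> of_rat k \<longleftrightarrow>
    (\<exists>r\<in>L. MFE \<Omega> E s (of_rat T) \<le> of_rat r \<and> r \<le> k)"
proof -
  have "MFE \<Omega> E s (of_rat T) \<in> E s (of_rat T) ` \<Omega> s"
    unfolding MFE_def using assms by (intro Min_in) auto
  then obtain r where "r \<in> L" "MFE \<Omega> E s (of_rat T) = of_rat r" using assms(3) by blast
  then show ?thesis by (metis of_rat_less_eq order.trans order.refl)
qed

section \<open>The reduction program\<close>

fun cells :: "data \<Rightarrow> nat" where
  "cells (Num i) = 0"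
| "cells (Cell a b) = 1 + cells a + cells b"

fun spine :: "data \<Rightarrow> nat" where
  "spine (Num i) = 0"
| "spine (Cell a b) = 1 + spine b"

lemma spine_le_cells: "spine d \<le> cells d"
  by (induction d) auto

lemma cells_less_bit_size: "cells d < bit_size d"
  by (induction d) auto

lemma length_le_cells_enc_list: "length xs \<le> cells (enc_list enc xs)"
  by (induction xs) auto

lemma num_bases_le_cells: "num_bases s \<le> cells (enc_strands s)"
proof (induction s)
  case (Cons x s)
  then show ?case
    using length_le_cells_enc_list[of x enc_base]
    by (simp add: num_bases_def enc_strands_def)
qed (simp add: num_bases_def)

text \<open>
  The program only needs a polynomially bounded upper bound for the number of bases; the number of
  cells of the encoded strands is one. Rotating \<open>Cell (Cell a b) c\<close> to \<open>Cell a (Cell b c)\<close> preserves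
  this number and lengthens the right spine, so at most \<open>2 * cells d - spine d\<close> iterations occur.
\<close>

definition count_loop :: "nat \<Rightarrow> nat \<Rightarrow> com" where
  "count_loop x c =
    WHILE (IsCell (Var x))
      (IF (IsCell (Left (Var x)))
        (Assign x (Mk (Left (Left (Var x))) (Mk (Right (Left (Var x))) (Right (Var x)))))
        (Seq (Assign x (Right (Var x))) (Assign c (Add (Var c) (Lit 1)))))"

lemma run_count_loop:
  assumes "x \<noteq> c" "bounded_store S \<sigma>" "S < B" "\<sigma> x = d" "\<sigma> c = Num (int m)" "m + cells d < S"
  shows "\<exists>i. bit_size (Num i) \<le> S \<and> run Orc (count_loop x c) \<sigma> (Suc (2 * cells d - spine d) * B)
    (\<sigma>(x := Num i, c := Num (int (m + cells d))))"
  using assms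
proof (induction "2 * cells d - spine d" arbitrary: d m \<sigma> rule: less_induct)
  case less
  note bd = less.prems(2) and d = less.prems(4) and m = less.prems(5)
  have dS: "bit_size d \<le> S" using bd d by (auto simp: bounded_store_def)
  let ?body = "IF (IsCell (Left (Var x)))
    (Assign x (Mk (Left (Left (Var x))) (Mk (Right (Left (Var x))) (Right (Var x)))))
    (Seq (Assign x (Right (Var x))) (Assign c (Add (Var c) (Lit 1))))"
  consider i where "d = Num i" | i b where "d = Cell (Num i) b" | a a' b where "d = Cell (Cell a a') b"
    by (metis data.exhaust)
  then show ?case
  proof cases
    case 1
    then have "\<sigma>(x := Num i, c := Num (int (m + cells d))) = \<sigma>"
      using d m by (auto simp: fun_eq_iff)
    moreover have "run Orc (count_loop x c) \<sigma> B \<sigma>"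
      unfolding count_loop_def using bd less.prems(3) 1 d by (intro run_WHILE_stop) auto
    ultimately show ?thesis using 1 dS by (intro exI[of _ i]) simp
  next
    case 2
    let ?\<rho>1 = "\<sigma>(x := b)"
    let ?\<rho> = "?\<rho>1(c := Num (int (Suc m)))"
    have bd1: "bounded_store S ?\<rho>1" using bd dS 2 by (intro bounded_store_upd) auto
    have "bit_size (Num (int (Suc m))) \<le> S"
      using bit_size_Num_le[of "int (Suc m)"] less.prems(6) 2 by simp
    then have bd2: "bounded_store S ?\<rho>" using bd1 by (intro bounded_store_upd[of _ ?\<rho>1])
    have "run Orc (Assign x (Right (Var x))) \<sigma> B ?\<rho>1"
      using run_Assign[OF bd less.prems(3), of Orc x "Right (Var x)"] d 2 by simp
    moreover have "run Orc (Assign c (Add (Var c) (Lit 1))) ?\<rho>1 B ?\<rho>"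
      using run_Assign[OF bd1 less.prems(3), of Orc c "Add (Var c) (Lit 1)"] m less.prems(1)
      by (simp add: add.commute)
    ultimately have body: "run Orc ?body \<sigma> B ?\<rho>"
      using bd less.prems(3) d 2 by (intro run_IF) (auto intro: run_Seq)
    have "\<exists>i. bit_size (Num i) \<le> S \<and> run Orc (count_loop x c) ?\<rho> (Suc (2 * cells b - spine b) * B)
        (?\<rho>(x := Num i, c := Num (int (Suc m + cells b))))"
      using less.prems 2 bd2 spine_le_cells[of b] by (intro less.hyps) auto
    then obtain i where i: "bit_size (Num i) \<le> S" and "run Orc (count_loop x c) ?\<rho> (Suc (2 * cells b - spine b) * B)
        (?\<rho>(x := Num i, c := Num (int (Suc m + cells b))))" by blast
    moreover have "val (IsCell (Var x)) \<sigma> \<noteq> Num 0" using d 2 by simp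
    ultimately have "run Orc (count_loop x c) \<sigma> (Suc (Suc (2 * cells b - spine b)) * B)
        (?\<rho>(x := Num i, c := Num (int (Suc m + cells b))))"
      unfolding count_loop_def by (intro run_WHILE_step[OF bd less.prems(3) _ body])
    moreover have "?\<rho>(x := Num i, c := Num (int (Suc m + cells b))) =
        \<sigma>(x := Num i, c := Num (int (m + cells d)))"
      using less.prems(1) 2 by (auto simp: fun_eq_iff)
    moreover have "2 * cells d - spine d = Suc (2 * cells b - spine b)"
      using 2 spine_le_cells[of b] by simp
    ultimately show ?thesis using i by (intro exI[of _ i]) metis
  next
    case 3
    let ?d = "Cell a (Cell a' b)"
    let ?\<rho> = "\<sigma>(x := ?d)"
    have bd1: "bounded_store S ?\<rho>" using bd dS 3 by (intro bounded_store_upd) auto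
    have body: "run Orc ?body \<sigma> B ?\<rho>"
      using bd less.prems(3) d 3
        run_Assign[OF bd less.prems(3), of Orc x "Mk (Left (Left (Var x))) (Mk (Right (Left (Var x))) (Right (Var x)))"]
      by (intro run_IF) auto
    have "\<exists>i. bit_size (Num i) \<le> S \<and> run Orc (count_loop x c) ?\<rho> (Suc (2 * cells ?d - spine ?d) * B)
        (?\<rho>(x := Num i, c := Num (int (m + cells ?d))))"
      using less.prems 3 bd1 spine_le_cells[of b] by (intro less.hyps) auto
    then obtain i where i: "bit_size (Num i) \<le> S" and "run Orc (count_loop x c) ?\<rho> (Suc (2 * cells ?d - spine ?d) * B)
        (?\<rho>(x := Num i, c := Num (int (m + cells ?d))))" by blast
    moreover have "val (IsCell (Var x)) \<sigma> \<noteq> Num 0" using d 3 by simp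
    ultimately have "run Orc (count_loop x c) \<sigma> (Suc (Suc (2 * cells ?d - spine ?d)) * B)
        (?\<rho>(x := Num i, c := Num (int (m + cells ?d))))"
      unfolding count_loop_def by (intro run_WHILE_step[OF bd less.prems(3) _ body])
    moreover have "?\<rho>(x := Num i, c := Num (int (m + cells ?d))) =
        \<sigma>(x := Num i, c := Num (int (m + cells d)))"
      using less.prems(1) 3 by (auto simp: fun_eq_iff)
    moreover have "2 * cells d - spine d = Suc (2 * cells ?d - spine ?d)"
      using 3 spine_le_cells[of b] by simp
    ultimately show ?thesis using i by (intro exI[of _ i]) metis
  qed
qed

definition power_loop :: "nat \<Rightarrow> nat \<Rightarrow> nat \<Rightarrow> nat \<Rightarrow> nat \<Rightarrow> com" where
  "power_loop A M I P D =
    WHILE (Var I)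
      (Seq (Assign P (Mul (Var P) (Sub (Var M) (Var A))))
      (Seq (Assign D (Mul (Var D) (Var M)))
        (Assign I (Sub (Var I) (Lit 1)))))"

lemma run_power_loop:
  assumes "distinct [A, M, I, P, D]" "bounded_store S \<sigma>" "S < B"
    and "\<sigma> I = Num (int j)" "\<sigma> A = Num a" "\<sigma> M = Num m" "\<sigma> P = Num u" "\<sigma> D = Num v"
    and "\<And>i. i \<le> j \<Longrightarrow> bit_size (Num (u * (m - a) ^ i)) \<le> S"
    and "\<And>i. i \<le> j \<Longrightarrow> bit_size (Num (v * m ^ i)) \<le> S"
  shows "run Orc (power_loop A M I P D) \<sigma> (Suc j * B)
    (\<sigma>(I := Num 0, P := Num (u * (m - a) ^ j), D := Num (v * m ^ j)))"
  using assms
proof (induction j arbitrary: \<sigma> u v)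
  case 0
  then have "\<sigma>(I := Num 0, P := Num (u * (m - a) ^ 0), D := Num (v * m ^ 0)) = \<sigma>"
    by (auto simp: fun_eq_iff)
  moreover have "run Orc (power_loop A M I P D) \<sigma> B \<sigma>"
    unfolding power_loop_def using 0 by (intro run_WHILE_stop) auto
  ultimately show ?case by (metis mult_1 One_nat_def)
next
  case (Suc j)
  note bd = Suc.prems(2) and B = Suc.prems(3)
  let ?body = "Seq (Assign P (Mul (Var P) (Sub (Var M) (Var A))))
      (Seq (Assign D (Mul (Var D) (Var M)))
        (Assign I (Sub (Var I) (Lit 1))))"
  let ?\<rho>1 = "\<sigma>(P := Num (u * (m - a)))"
  let ?\<rho>2 = "?\<rho>1(D := Num (v * m))"
  let ?\<rho> = "?\<rho>2(I := Num (int j))"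
  have bd1: "bounded_store S ?\<rho>1"
    using bd Suc.prems(9)[of 1] by (intro bounded_store_upd) auto
  have bd2: "bounded_store S ?\<rho>2"
    using bd1 Suc.prems(10)[of 1] by (intro bounded_store_upd[of _ ?\<rho>1]) auto
  have "bit_size (Num (int j)) \<le> bit_size (\<sigma> I)"
    unfolding Suc.prems(4) by (intro bit_size_Num_mono) auto
  also have "\<dots> \<le> S" using bd by (auto simp: bounded_store_def)
  finally have bd3: "bounded_store S ?\<rho>" by (intro bounded_store_upd bd2)
  have "run Orc (Assign P (Mul (Var P) (Sub (Var M) (Var A)))) \<sigma> B ?\<rho>1"
    using run_Assign[OF bd B, of Orc P "Mul (Var P) (Sub (Var M) (Var A))"] Suc.prems by simp
  moreover have "run Orc (Assign D (Mul (Var D) (Var M))) ?\<rho>1 B ?\<rho>2"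
    using run_Assign[OF bd1 B, of Orc D "Mul (Var D) (Var M)"] Suc.prems(1,6,8) by (auto split: if_splits)
  moreover have "run Orc (Assign I (Sub (Var I) (Lit 1))) ?\<rho>2 B ?\<rho>"
    using run_Assign[OF bd2 B, of Orc I "Sub (Var I) (Lit 1)"] Suc.prems by simp
  ultimately have body: "run Orc ?body \<sigma> B ?\<rho>"
    by (intro run_Seq)
  have "run Orc (power_loop A M I P D) ?\<rho> (Suc j * B)
    (?\<rho>(I := Num 0, P := Num (u * (m - a) * (m - a) ^ j), D := Num (v * m * m ^ j)))"
    using Suc.prems(1-8) bd3 Suc.prems(9)[of "Suc i" for i] Suc.prems(10)[of "Suc i" for i]
    by (intro Suc.IH[OF Suc.prems(1) bd3 B]) (auto simp: mult.assoc)
  then have "run Orc (power_loop A M I P D) \<sigma> (Suc (Suc j) * B)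
    (?\<rho>(I := Num 0, P := Num (u * (m - a) * (m - a) ^ j), D := Num (v * m * m ^ j)))"
    unfolding power_loop_def using Suc.prems(4) by (intro run_WHILE_step[OF bd B _ body]) auto
  moreover have "?\<rho>(I := Num 0, P := Num (u * (m - a) * (m - a) ^ j), D := Num (v * m * m ^ j)) =
    \<sigma>(I := Num 0, P := Num (u * (m - a) ^ Suc j), D := Num (v * m ^ Suc j))"
    using Suc.prems(1) by (auto simp: fun_eq_iff)
  ultimately show ?case by metis
qed

lemma quotient_ceiling: "- (- x div y) = \<lceil>of_int x / of_int y :: rat\<rceil>"
  by (simp add: ceiling_divide_eq_div)

text \<open>
  Variables of the reduction, for a base index \<open>h\<close> above all variables of the program computing the
  levels: \<open>0\<close> remaining levels, \<open>h\<close> input, \<open>h + 1\<close> and \<open>h + 2\<close> tree and counter of the cell count,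
  \<open>h + 3\<close> the scale \<open>q\<close>, \<open>h + 4\<close> and \<open>h + 5\<close> numerator and denominator of \<open>\<alpha>\<close>, \<open>h + 6\<close> the rounded
  exponent \<open>a\<close>, \<open>h + 7\<close> the number \<open>m = 2 a\<^sup>2 + 1\<close>, \<open>h + 8\<close> the power counter, \<open>h + 9\<close> and \<open>h + 10\<close>
  numerator and denominator of the threshold, \<open>h + 11\<close> the oracle's answer, \<open>h + 12\<close> the result.
\<close>

definition round_exp :: "nat \<Rightarrow> int \<Rightarrow> int \<Rightarrow> exp" where
  "round_exp h k1 k2 = Sub (Lit 0) (Div
    (Sub (Lit 0) (Mul (Mul (Mul (Var (h + 4)) (Lit k2)) (Right (Left (Right (Left (Var h))))))
      (Left (Left (Var 0)))))
    (Mul (Mul (Mul (Var (h + 5)) (Lit k1)) (Left (Left (Right (Left (Var h))))))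
      (Right (Left (Var 0)))))"

definition query_exp :: "nat \<Rightarrow> exp" where
  "query_exp h = Mk
    (Mk (Left (Left (Var h)))
      (Mk (Left (Right (Left (Var h))))
        (Mk (Right (Right (Left (Var h)))) (Mk (Var (h + 4)) (Var (h + 5))))))
    (Mk (Var (h + 9)) (Var (h + 10)))"

definition accept_exp :: "nat \<Rightarrow> exp" where
  "accept_exp h = Less (Lit 0) (Add (Var (h + 12)) (Mul (Var (h + 11)) (Sub (Lit 1)
    (Less (Mul (Left (Right (Var h))) (Right (Left (Var 0))))
      (Mul (Left (Left (Var 0))) (Right (Right (Var h))))))))"

definition level_body :: "nat \<Rightarrow> int \<Rightarrow> int \<Rightarrow> com" where
  "level_body h k1 k2 =
    Seq (Assign (h + 6) (round_exp h k1 k2))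
    (Seq (Assign (h + 7) (Add (Mul (Lit 2) (Mul (Var (h + 6)) (Var (h + 6)))) (Lit 1)))
    (Seq (Assign (h + 8) (Var (h + 7)))
    (Seq (Assign (h + 9) (Lit 1))
    (Seq (Assign (h + 10) (Lit 1))
    (Seq (power_loop (h + 6) (h + 7) (h + 8) (h + 9) (h + 10))
    (Seq (Query (h + 11) (query_exp h))
    (Seq (Assign (h + 12) (accept_exp h))
      (Assign 0 (Right (Var 0))))))))))"

definition level_query :: "data \<Rightarrow> rat \<Rightarrow> data \<Rightarrow> rat \<Rightarrow> int \<Rightarrow> data" where
  "level_query ds T dm \<alpha> a =
    Cell (Cell ds (Cell (enc_rat T) (Cell dm (enc_rat \<alpha>)))) (enc_rat (threshold a))"

definition fits :: "nat \<Rightarrow> int \<Rightarrow> bool" where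
  "fits S a \<longleftrightarrow> bit_size (Num a) \<le> S \<and> nat (exponent a) < S \<and>
    (\<forall>i\<le>nat (exponent a). bit_size (Num ((exponent a - a) ^ i)) \<le> S \<and>
      bit_size (Num (exponent a ^ i)) \<le> S)"

definition level_store ::
  "nat \<Rightarrow> rat \<Rightarrow> data \<Rightarrow> data \<Rightarrow> rat \<Rightarrow> rat \<Rightarrow> bool \<Rightarrow> store \<Rightarrow> bool" where
  "level_store h T ds dm k \<alpha> b \<sigma> \<longleftrightarrow>
    \<sigma> h = Cell (Cell ds (Cell (enc_rat T) dm)) (enc_rat k) \<and>
    \<sigma> (h + 4) = Num (fst (quotient_of \<alpha>)) \<and> \<sigma> (h + 5) = Num (snd (quotient_of \<alpha>)) \<and>
    \<sigma> (h + 12) = Num (of_bool b)"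

lemma run_level_body:
  assumes "0 < h" "0 < kB" "0 < T" "level_store h T ds dm k \<alpha> b \<sigma>"
    and \<sigma>0: "\<sigma> 0 = Cell (enc_rat r) l"
    and kB: "quotient_of kB = (k1, k2)"
    and bd: "bounded_store S \<sigma>" and B: "(S + 1) * (S + 1) \<le> B" and S: "2 \<le> S"
    and fits: "fits S \<lceil>\<alpha> / (kB * T) * r\<rceil>"
  shows "\<exists>\<tau>. run Orc (level_body h k1 k2) \<sigma> B \<tau> \<and> bounded_store S \<tau> \<and> \<tau> 0 = l \<and>
    level_store h T ds dm k \<alpha>
      (b \<or> Orc (level_query ds T dm \<alpha> \<lceil>\<alpha> / (kB * T) * r\<rceil>) \<and> r \<le> k) \<tau>"
proof -
  define a where "a = \<lceil>\<alpha> / (kB * T) * r\<rceil>"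
  define m where "m = exponent a"
  obtain p d where r: "quotient_of r = (p, d)" by force
  obtain t1 t2 where T: "quotient_of T = (t1, t2)" by force
  obtain a1 a2 where \<alpha>: "quotient_of \<alpha> = (a1, a2)" by force
  obtain n1 n2 where k: "quotient_of k = (n1, n2)" by force
  note enc = enc_rat_def r T \<alpha> k
  have \<sigma>: "\<sigma> h = Cell (Cell ds (Cell (Cell (Num t1) (Num t2)) dm)) (Cell (Num n1) (Num n2))"
    "\<sigma> (h + 4) = Num a1" "\<sigma> (h + 5) = Num a2" "\<sigma> (h + 12) = Num (of_bool b)"
    "\<sigma> 0 = Cell (Cell (Num p) (Num d)) l"
    using assms(4) \<sigma>0 by (auto simp: level_store_def enc)
  have eqs: "r = of_int p / of_int d" "0 < d" "T = of_int t1 / of_int t2" "0 < t2"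
    "\<alpha> = of_int a1 / of_int a2" "0 < a2" "k = of_int n1 / of_int n2" "0 < n2"
    "kB = of_int k1 / of_int k2" "0 < k2"
    using quotient_of_imp_eq[OF r] quotient_of_imp_eq[OF T] quotient_of_imp_eq[OF \<alpha>]
      quotient_of_imp_eq[OF k] quotient_of_imp_eq[OF kB] by auto
  have pos: "0 < t1" "0 < k1"
    using assms(2,3) eqs by (auto simp: zero_less_divide_iff)
  have le: "r \<le> k \<longleftrightarrow> \<not> n1 * d < p * n2"
  proof -
    have "r \<le> k \<longleftrightarrow> (of_int (p * n2) :: rat) \<le> of_int (n1 * d)"
      unfolding eqs(1,7) using eqs(2,8) by (simp add: field_simps)
    then show ?thesis by (simp only: of_int_le_iff not_less)
  qed
  have "of_int (a1 * k2 * t2 * p) / of_int (a2 * k1 * t1 * d) = \<alpha> / (kB * T) * r"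
    unfolding eqs(1,3,5,9) using eqs(2,4,6,10) pos by (simp add: field_simps)
  then have a_eq: "- (- (a1 * k2 * t2 * p) div (a2 * k1 * t1 * d)) = a"
    unfolding quotient_ceiling a_def by simp
  have fits': "bit_size (Num a) \<le> S" "nat m < S"
    "\<And>i. i \<le> nat m \<Longrightarrow> bit_size (Num ((m - a) ^ i)) \<le> S"
    "\<And>i. i \<le> nat m \<Longrightarrow> bit_size (Num (m ^ i)) \<le> S"
    using fits by (auto simp: fits_def a_def m_def)
  have m: "0 < m" "m = 2 * (a * a) + 1"
    using exponent_pos by (auto simp: m_def exponent_def power2_eq_square)
  have SB: "S < B" using B by (simp add: algebra_simps)
  have one: "bit_size (Num 1) \<le> S" "bit_size (Num 0) \<le> S" "\<And>P. bit_size (Num (of_bool P)) \<le> S"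
    using S by (auto simp: floorlog_def of_bool_def)
  have lS: "bit_size l \<le> S"
    using bd \<sigma>(5) unfolding bounded_store_def by (metis add_leE bit_size.simps(2))
  let ?s1 = "\<sigma>(h + 6 := Num a)"
  let ?s2 = "?s1(h + 7 := Num m)"
  let ?s3 = "?s2(h + 8 := Num m)"
  let ?s4 = "?s3(h + 9 := Num 1)"
  let ?s5 = "?s4(h + 10 := Num 1)"
  let ?s6 = "?s5(h + 8 := Num 0, h + 9 := Num (1 * (m - a) ^ nat m), h + 10 := Num (1 * m ^ nat m))"
  let ?ans = "Orc (level_query ds T dm \<alpha> a)"
  let ?s7 = "?s6(h + 11 := Num (of_bool ?ans))"
  let ?s8 = "?s7(h + 12 := Num (of_bool (b \<or> ?ans \<and> r \<le> k)))"
  let ?s9 = "?s8(0 := l)"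
  have bd1: "bounded_store S ?s1" by (intro bounded_store_upd bd fits')
  have mS: "bit_size (Num m) \<le> S" using fits'(2) bit_size_Num_le[of m] m(1) by linarith
  have bd2: "bounded_store S ?s2" by (rule bounded_store_upd[OF bd1 mS])
  have bd3: "bounded_store S ?s3" by (rule bounded_store_upd[OF bd2 mS])
  have bd4: "bounded_store S ?s4" by (rule bounded_store_upd[OF bd3 one(1)])
  have bd5: "bounded_store S ?s5" by (rule bounded_store_upd[OF bd4 one(1)])
  have bd6: "bounded_store S ?s6"
    unfolding mult_1 by (intro bounded_store_upd[OF bounded_store_upd[OF bounded_store_upd[OF bd5]]]
      one fits' order.refl)
  have bd7: "bounded_store S ?s7" by (rule bounded_store_upd[OF bd6 one(3)])
  have bd8: "bounded_store S ?s8" by (rule bounded_store_upd[OF bd7 one(3)])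
  have bd9: "bounded_store S ?s9" by (rule bounded_store_upd[OF bd8 lS])
  have "run Orc (Assign (h + 6) (round_exp h k1 k2)) \<sigma> B ?s1"
    using run_Assign[OF bd SB, of Orc "h + 6" "round_exp h k1 k2"] \<sigma> a_eq by (simp add: round_exp_def)
  moreover have "run Orc (Assign (h + 7) (Add (Mul (Lit 2) (Mul (Var (h + 6)) (Var (h + 6)))) (Lit 1))) ?s1 B ?s2"
    using run_Assign[OF bd1 SB, of Orc "h + 7" "Add (Mul (Lit 2) (Mul (Var (h + 6)) (Var (h + 6)))) (Lit 1)"] m
    by simp
  moreover have "run Orc (Assign (h + 8) (Var (h + 7))) ?s2 B ?s3"
    using run_Assign[OF bd2 SB, of Orc "h + 8" "Var (h + 7)"] by simp
  moreover have "run Orc (Assign (h + 9) (Lit 1)) ?s3 B ?s4"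
    using run_Assign[OF bd3 SB, of Orc "h + 9" "Lit 1"] by simp
  moreover have "run Orc (Assign (h + 10) (Lit 1)) ?s4 B ?s5"
    using run_Assign[OF bd4 SB, of Orc "h + 10" "Lit 1"] by simp
  moreover have "run Orc (power_loop (h + 6) (h + 7) (h + 8) (h + 9) (h + 10)) ?s5 B ?s6"
  proof (rule run_mono)
    show "run Orc (power_loop (h + 6) (h + 7) (h + 8) (h + 9) (h + 10)) ?s5 (Suc (nat m) * (S + 1)) ?s6"
      using m(1) fits'(3,4) by (intro run_power_loop[OF _ bd5]) auto
    have "Suc (nat m) * (S + 1) \<le> (S + 1) * (S + 1)"
      using fits'(2) by (intro mult_le_mono1) simp
    then show "Suc (nat m) * (S + 1) \<le> B" using B by linarith
  qed
  moreover have "run Orc (Query (h + 11) (query_exp h)) ?s6 B ?s7"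
    using run_Query[OF bd6 SB, of Orc "h + 11" "query_exp h"] \<sigma> assms(1)
      quotient_of_threshold[of a]
    by (simp add: query_exp_def level_query_def enc m_def)
  moreover have "run Orc (Assign (h + 12) (accept_exp h)) ?s7 B ?s8"
  proof -
    have "val (accept_exp h) ?s7 = Num (of_bool (b \<or> ?ans \<and> r \<le> k))"
      using \<sigma> assms(1) by (simp add: accept_exp_def le)
    then show ?thesis using run_Assign[OF bd7 SB, of Orc "h + 12" "accept_exp h"] by simp
  qed
  moreover have "run Orc (Assign 0 (Right (Var 0))) ?s8 B ?s9"
    using run_Assign[OF bd8 SB, of Orc 0 "Right (Var 0)"] \<sigma> assms(1) by simp
  ultimately have "run Orc (level_body h k1 k2) \<sigma> B ?s9"
    unfolding level_body_def by (intro run_Seq)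
  moreover have "level_store h T ds dm k \<alpha> (b \<or> ?ans \<and> r \<le> k) ?s9"
    using assms(1,4) by (simp add: level_store_def)
  ultimately show ?thesis using bd9 unfolding a_def[symmetric] by (intro exI[of _ ?s9]) simp
qed

definition level_loop :: "nat \<Rightarrow> int \<Rightarrow> int \<Rightarrow> com" where
  "level_loop h k1 k2 = WHILE (IsCell (Var 0)) (level_body h k1 k2)"

lemma run_level_loop:
  assumes "0 < h" "0 < kB" "0 < T" "level_store h T ds dm k \<alpha> b \<sigma>"
    and "\<sigma> 0 = enc_list enc_rat rs"
    and "quotient_of kB = (k1, k2)"
    and "bounded_store S \<sigma>" and "(S + 1) * (S + 1) \<le> B" and "2 \<le> S"
    and "\<And>r. r \<in> set rs \<Longrightarrow> fits S \<lceil>\<alpha> / (kB * T) * r\<rceil>"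
  shows "\<exists>\<tau>. run Orc (level_loop h k1 k2) \<sigma> (Suc (length rs) * B) \<tau> \<and> bounded_store S \<tau> \<and>
    level_store h T ds dm k \<alpha>
      (b \<or> (\<exists>r\<in>set rs. Orc (level_query ds T dm \<alpha> \<lceil>\<alpha> / (kB * T) * r\<rceil>) \<and> r \<le> k)) \<tau>"
  using assms
proof (induction rs arbitrary: b \<sigma>)
  case Nil
  have "S < B" using Nil.prems(8) by (simp add: algebra_simps)
  then have "run Orc (level_loop h k1 k2) \<sigma> B \<sigma>"
    unfolding level_loop_def using Nil by (intro run_WHILE_stop) auto
  then show ?case using Nil by auto
next
  case (Cons r rs)
  let ?ans = "Orc (level_query ds T dm \<alpha> \<lceil>\<alpha> / (kB * T) * r\<rceil>) \<and> r \<le> k"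
  have SB: "S < B" using Cons.prems(8) by (simp add: algebra_simps)
  obtain \<rho> where \<rho>: "run Orc (level_body h k1 k2) \<sigma> B \<rho>" "bounded_store S \<rho>"
    "\<rho> 0 = enc_list enc_rat rs" "level_store h T ds dm k \<alpha> (b \<or> ?ans) \<rho>"
    using run_level_body[OF Cons.prems(1-4) _ Cons.prems(6-9)] Cons.prems(5,10) by fastforce
  obtain \<tau> where \<tau>: "run Orc (level_loop h k1 k2) \<rho> (Suc (length rs) * B) \<tau>" "bounded_store S \<tau>"
    "level_store h T ds dm k \<alpha>
      ((b \<or> ?ans) \<or> (\<exists>r\<in>set rs. Orc (level_query ds T dm \<alpha> \<lceil>\<alpha> / (kB * T) * r\<rceil>) \<and> r \<le> k)) \<tau>"
    using Cons.IH[OF Cons.prems(1-3) \<rho>(4,3) Cons.prems(6) \<rho>(2) Cons.prems(8,9)] Cons.prems(10)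
    by fastforce
  have "run Orc (level_loop h k1 k2) \<sigma> (Suc (length (r # rs)) * B) \<tau>"
    unfolding level_loop_def length_Cons
    using Cons.prems(5) \<tau>(1)[unfolded level_loop_def]
    by (intro run_WHILE_step[OF Cons.prems(7) SB _ \<rho>(1)]) simp_all
  then show ?case using \<tau>(2,3) by (intro exI[of _ \<tau>]) (simp add: disj_assoc)
qed

primrec power_exp :: "exp \<Rightarrow> nat \<Rightarrow> exp" where
  "power_exp e 0 = Lit 1"
| "power_exp e (Suc n) = Mul e (power_exp e n)"

lemma val_power_exp: "val (power_exp e n) \<sigma> = Num (the_num (val e \<sigma>) ^ n)"
  by (induction n) auto

definition scale :: "nat \<Rightarrow> nat \<Rightarrow> nat" where
  "scale \<kappa> n = (n\<^sup>2 + 3) * ((n + 2) ^ \<kappa>)\<^sup>2"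

definition scale_exp :: "nat \<Rightarrow> exp \<Rightarrow> exp" where
  "scale_exp \<kappa> e = Mul (Add (power_exp e 2) (Lit 3)) (power_exp (power_exp (Add e (Lit 2)) \<kappa>) 2)"

lemma val_scale_exp:
  "val e \<sigma> = Num (int n) \<Longrightarrow> val (scale_exp \<kappa> e) \<sigma> = Num (int (scale \<kappa> n))"
  by (simp add: scale_exp_def val_power_exp scale_def add.commute)

lemma scale_pos: "0 < scale \<kappa> n"
  by (simp add: scale_def)

definition mag_num_exp :: "nat \<Rightarrow> int \<Rightarrow> int \<Rightarrow> exp" where
  "mag_num_exp h k1 k2 = Sub (Lit 0) (Div
    (Sub (Lit 0) (Mul (Mul (Var (h + 3)) (Lit k1)) (Left (Left (Right (Left (Var h)))))))
    (Mul (Lit k2) (Right (Left (Right (Left (Var h)))))))"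

definition mag_inv_exp :: "nat \<Rightarrow> int \<Rightarrow> int \<Rightarrow> exp" where
  "mag_inv_exp h k1 k2 = Div
    (Mul (Lit k2) (Right (Left (Right (Left (Var h))))))
    (Mul (Mul (Var (h + 3)) (Lit k1)) (Left (Left (Right (Left (Var h))))))"

definition mag_den_exp :: "nat \<Rightarrow> int \<Rightarrow> int \<Rightarrow> exp" where
  "mag_den_exp h k1 k2 = Add (mag_inv_exp h k1 k2) (Less (mag_inv_exp h k1 k2) (Lit 1))"

lemma val_mag_exps:
  assumes "0 < kB" "0 < T" "0 < q" "quotient_of kB = (k1, k2)"
    and "\<sigma> h = Cell (Cell ds (Cell (enc_rat T) dm)) dk" "\<sigma> (h + 3) = Num (int q)"
  shows "val (mag_num_exp h k1 k2) \<sigma> = Num (fst (quotient_of (magnification (kB * T) q)))" (is ?num)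
    and "val (mag_den_exp h k1 k2) \<sigma> = Num (snd (quotient_of (magnification (kB * T) q)))" (is ?den)
    and "bit_size (val (mag_num_exp h k1 k2) \<sigma>) \<le>
      bit_size (Num (int q)) + bit_size (Num k1) + bit_size (enc_rat T)" (is ?num_size)
    and "bit_size (val (mag_den_exp h k1 k2) \<sigma>) \<le> 2 + bit_size (Num k2) + bit_size (enc_rat T)" (is ?den_size)
proof -
  obtain t1 t2 where T: "quotient_of T = (t1, t2)" by force
  have eqs: "T = of_int t1 / of_int t2" "0 < t2" "kB = of_int k1 / of_int k2" "0 < k2"
    using quotient_of_imp_eq[OF T] quotient_of_imp_eq[OF assms(4)] by auto
  have pos: "0 < t1" "0 < k1"
    using assms(1,2) eqs by (auto simp: zero_less_divide_iff)
  define z1 where "z1 = int q * k1 * t1"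
  define z2 where "z2 = k2 * t2"
  have z: "0 < z1" "0 < z2" using pos eqs assms(3) by (auto simp: z1_def z2_def)
  have ratio: "of_int z1 / of_int z2 = of_nat q * (kB * T)"
    using eqs by (simp add: z1_def z2_def)
  have quot: "quotient_of (magnification (kB * T) q) = (- (- z1 div z2), max 1 (z2 div z1))"
  proof -
    have "1 / (of_nat q * (kB * T)) = of_int z2 / of_int z1" unfolding ratio[symmetric] by simp
    then show ?thesis
      unfolding quotient_ceiling ratio
      using quotient_of_magnification[of "kB * T" q] assms(1-3) floor_divide_of_int_eq[of z2 z1, where 'a = rat] by simp
  qed
  have num: "val (mag_num_exp h k1 k2) \<sigma> = Num (- (- z1 div z2))"
    using assms(5,6) by (simp add: mag_num_exp_def enc_rat_def T z1_def z2_def)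
  have inv: "val (mag_inv_exp h k1 k2) \<sigma> = Num (z2 div z1)"
    using assms(5,6) by (simp add: mag_inv_exp_def enc_rat_def T z1_def z2_def)
  have "0 \<le> z2 div z1" using z by (simp add: pos_imp_zdiv_nonneg_iff)
  then have den: "val (mag_den_exp h k1 k2) \<sigma> = Num (max 1 (z2 div z1))"
    by (auto simp: mag_den_exp_def inv)
  show ?num using num quot by simp
  show ?den using den quot by simp
  have "bit_size (Num (- (- z1 div z2))) \<le> bit_size (Num z1)"
    using abs_div_le_abs[of "- z1" z2] by (intro bit_size_Num_mono) auto
  also have "\<dots> \<le> bit_size (Num (int q * k1)) + bit_size (Num t1)"
    using bit_size_Num_mult_le[of "Num (int q * k1)" "Num t1"] by (simp add: z1_def)
  also have "bit_size (Num (int q * k1)) \<le> bit_size (Num (int q)) + bit_size (Num k1)"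
    using bit_size_Num_mult_le[of "Num (int q)" "Num k1"] by simp
  finally show ?num_size unfolding num by (simp add: enc_rat_def T)
  have "bit_size (Num (max 1 (z2 div z1))) \<le> bit_size (Num z2)"
    using abs_div_le_abs[of z2 z1] z by (intro bit_size_Num_mono) auto
  also have "\<dots> \<le> bit_size (Num k2) + bit_size (Num t2)"
    using bit_size_Num_mult_le[of "Num k2" "Num t2"] by (simp add: z2_def)
  finally show ?den_size unfolding den by (simp add: enc_rat_def T)
qed

definition room :: "nat \<Rightarrow> nat" where
  "room A = (2 * A\<^sup>2 + 1 + A) * (2 * A\<^sup>2 + 1) + (2 * A\<^sup>2 + 1) + A + 3"

lemma fits_room:
  assumes "\<bar>a\<bar> \<le> int A" "room A \<le> S"
  shows "fits S a"
proof -
  define M where "M = 2 * A\<^sup>2 + 1"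
  have S: "(M + A) * M + M + A + 3 \<le> S" using assms(2) by (simp add: room_def M_def)
  have "a\<^sup>2 \<le> (int A)\<^sup>2" using assms(1) by (simp add: abs_le_square_iff[symmetric])
  then have m: "exponent a \<le> int M" by (simp add: exponent_def M_def)
  have m0: "0 < exponent a" by (rule exponent_pos)
  have le: "(M + A) * i + 2 \<le> S" if "i \<le> nat (exponent a)" for i
  proof -
    have "(M + A) * i \<le> (M + A) * M" using that m by (intro mult_le_mono2) linarith
    then show ?thesis using S by linarith
  qed
  have "bit_size (Num ((exponent a - a) ^ i)) \<le> S" "bit_size (Num (exponent a ^ i)) \<le> S"
    if "i \<le> nat (exponent a)" for i
    using bit_size_Num_power_le[of "exponent a - a" "M + A" i]
      bit_size_Num_power_le[of "exponent a" "M + A" i] le[OF that] m m0 assms(1)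
    by linarith+
  moreover have "bit_size (Num a) \<le> S"
    using bit_size_Num_le[of a] assms(1) S by linarith
  moreover have "nat (exponent a) < S" using m S by linarith
  ultimately show ?thesis by (simp add: fits_def)
qed

definition setup_com :: "nat \<Rightarrow> int \<Rightarrow> int \<Rightarrow> nat \<Rightarrow> com" where
  "setup_com h k1 k2 \<kappa> =
    Seq (Assign (h + 1) (Left (Left (Var h))))
    (Seq (Assign (h + 2) (Lit 0))
    (Seq (count_loop (h + 1) (h + 2))
    (Seq (Assign (h + 3) (scale_exp \<kappa> (Var (h + 2))))
    (Seq (Assign (h + 4) (mag_num_exp h k1 k2))
    (Seq (Assign (h + 5) (mag_den_exp h k1 k2))
      (Assign (h + 12) (Lit 0)))))))"

lemma run_setup_com:
  assumes "0 < h" "0 < kB" "0 < T" and kB: "quotient_of kB = (k1, k2)"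
    and \<sigma>: "\<sigma> h = Cell (Cell ds (Cell (enc_rat T) dm)) (enc_rat k)"
    and bd: "bounded_store S \<sigma>" and cells: "cells ds < S"
    and S: "bit_size (Num (int (scale \<kappa> (cells ds)))) + bit_size (Num k1) + bit_size (Num k2) +
      bit_size (enc_rat T) + 2 \<le> S"
    and B: "2 * S * (S + 1) \<le> B"
  shows "\<exists>\<tau>. run Orc (setup_com h k1 k2 \<kappa>) \<sigma> B \<tau> \<and> bounded_store S \<tau> \<and> \<tau> 0 = \<sigma> 0 \<and>
    level_store h T ds dm k (magnification (kB * T) (scale \<kappa> (cells ds))) False \<tau>"
proof -
  let ?q = "scale \<kappa> (cells ds)"
  have "2 * S * 1 \<le> 2 * S * (S + 1)" by (intro mult_le_mono2) simp
  then have SB: "S < B" using B S by linarith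
  have zero: "bit_size (Num 0) \<le> S" using S by (simp add: floorlog_def)
  let ?s1 = "\<sigma>(h + 1 := ds)"
  let ?s2 = "?s1(h + 2 := Num 0)"
  have dsS: "bit_size ds \<le> S" using bd \<sigma> unfolding bounded_store_def
    by (metis add_leE bit_size.simps(2))
  then have bd1: "bounded_store S ?s1" by (intro bounded_store_upd bd)
  then have bd2: "bounded_store S ?s2" using zero by (intro bounded_store_upd[of _ ?s1])
  have "\<exists>i. bit_size (Num i) \<le> S \<and> run Orc (count_loop (h + 1) (h + 2)) ?s2 (Suc (2 * cells ds - spine ds) * (S + 1))
    (?s2(h + 1 := Num i, h + 2 := Num (int (0 + cells ds))))"
    using cells by (intro run_count_loop[OF _ bd2]) auto
  then obtain i where iS: "bit_size (Num i) \<le> S" and i: "run Orc (count_loop (h + 1) (h + 2)) ?s2 (Suc (2 * cells ds - spine ds) * (S + 1))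
    (?s2(h + 1 := Num i, h + 2 := Num (int (cells ds))))" by auto
  have eq: "?s2(h + 1 := Num i, h + 2 := Num (int (cells ds))) =
    \<sigma>(h + 1 := Num i, h + 2 := Num (int (cells ds)))" by (auto simp: fun_eq_iff)
  let ?s3 = "\<sigma>(h + 1 := Num i, h + 2 := Num (int (cells ds)))"
  have "Suc (2 * cells ds - spine ds) * (S + 1) \<le> 2 * S * (S + 1)"
    using cells by (intro mult_le_mono1) simp
  then have run3: "run Orc (count_loop (h + 1) (h + 2)) ?s2 B ?s3"
    using run_mono[OF i[unfolded eq]] B le_trans by blast
  have "bounded_store S (\<sigma>(h + 1 := Num i))"
    by (rule bounded_store_upd[OF bd iS])
  then have bd3: "bounded_store S ?s3"
    using bit_size_Num_le[of "int (cells ds)"] cells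
    by (intro bounded_store_upd[of _ "\<sigma>(h + 1 := Num i)"]) auto
  let ?s4 = "?s3(h + 3 := Num (int ?q))"
  have bd4: "bounded_store S ?s4" using S by (intro bounded_store_upd[OF bd3]) simp
  let ?\<alpha> = "magnification (kB * T) ?q"
  have s4: "?s4 h = Cell (Cell ds (Cell (enc_rat T) dm)) (enc_rat k)" "?s4 (h + 3) = Num (int ?q)"
    using \<sigma> by auto
  note mag4 = val_mag_exps[OF assms(2,3) scale_pos kB s4]
  let ?s5 = "?s4(h + 4 := Num (fst (quotient_of ?\<alpha>)))"
  have bd5: "bounded_store S ?s5"
    using mag4(3)[unfolded mag4(1)] S by (intro bounded_store_upd[OF bd4]) linarith
  have s5: "?s5 h = Cell (Cell ds (Cell (enc_rat T) dm)) (enc_rat k)" "?s5 (h + 3) = Num (int ?q)"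
    using \<sigma> by auto
  note mag5 = val_mag_exps[OF assms(2,3) scale_pos kB s5]
  let ?s6 = "?s5(h + 5 := Num (snd (quotient_of ?\<alpha>)))"
  have bd6: "bounded_store S ?s6"
    using mag5(4)[unfolded mag5(2)] S by (intro bounded_store_upd[OF bd5]) linarith
  let ?s7 = "?s6(h + 12 := Num 0)"
  have bd7: "bounded_store S ?s7" by (intro bounded_store_upd[OF bd6] zero)
  have "run Orc (Assign (h + 1) (Left (Left (Var h)))) \<sigma> B ?s1"
    using run_Assign[OF bd SB, of Orc "h + 1" "Left (Left (Var h))"] \<sigma> by simp
  moreover have "run Orc (Assign (h + 2) (Lit 0)) ?s1 B ?s2"
    using run_Assign[OF bd1 SB, of Orc "h + 2" "Lit 0"] by simp
  moreover note run3
  moreover have "run Orc (Assign (h + 3) (scale_exp \<kappa> (Var (h + 2)))) ?s3 B ?s4"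
    using run_Assign[OF bd3 SB, of Orc "h + 3" "scale_exp \<kappa> (Var (h + 2))"]
      val_scale_exp[of "Var (h + 2)" ?s3 "cells ds" \<kappa>] by simp
  moreover have "run Orc (Assign (h + 4) (mag_num_exp h k1 k2)) ?s4 B ?s5"
    using run_Assign[OF bd4 SB, of Orc "h + 4" "mag_num_exp h k1 k2"] unfolding mag4(1) .
  moreover have "run Orc (Assign (h + 5) (mag_den_exp h k1 k2)) ?s5 B ?s6"
    using run_Assign[OF bd5 SB, of Orc "h + 5" "mag_den_exp h k1 k2"] unfolding mag5(2) .
  moreover have "run Orc (Assign (h + 12) (Lit 0)) ?s6 B ?s7"
    using run_Assign[OF bd6 SB, of Orc "h + 12" "Lit 0"] by simp
  ultimately have "run Orc (setup_com h k1 k2 \<kappa>) \<sigma> B ?s7"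
    unfolding setup_com_def by (intro run_Seq)
  moreover have "level_store h T ds dm k ?\<alpha> False ?s7" "?s7 0 = \<sigma> 0"
    using \<sigma> assms(1) by (auto simp: level_store_def)
  ultimately show ?thesis using bd7 by (intro exI[of _ ?s7]) simp
qed

definition reduction :: "nat \<Rightarrow> com \<Rightarrow> int \<Rightarrow> int \<Rightarrow> nat \<Rightarrow> com" where
  "reduction h c k1 k2 \<kappa> =
    Seq (Assign h (Var 0))
    (Seq (Assign 0 (Left (Var 0)))
    (Seq c
    (Seq (setup_com h k1 k2 \<kappa>)
    (Seq (level_loop h k1 k2)
      (Assign 0 (Var (h + 12)))))))"

lemma runs_within_reduction:
  assumes "0 < h" "0 < kB" "0 < T" and kB: "quotient_of kB = (k1, k2)"
    and c: "cvars c \<subseteq> {..<h}" "query_free c"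
    and run: "runs_within (\<lambda>_. False) c (Cell ds (Cell (enc_rat T) dm)) t (enc_list enc_rat rs)"
    and x: "x = Cell (Cell ds (Cell (enc_rat T) dm)) (enc_rat k)"
    and \<alpha>: "\<alpha> = magnification (kB * T) (scale \<kappa> (cells ds))"
    and S: "bit_size x + t + bit_size (Num (int (scale \<kappa> (cells ds)))) + bit_size (Num k1) +
      bit_size (Num k2) + 2 \<le> S"
    and fits: "\<And>r. r \<in> set rs \<Longrightarrow> fits S \<lceil>\<alpha> / (kB * T) * r\<rceil>"
  shows "runs_within Orc (reduction h c k1 k2 \<kappa>) x (ccoef (reduction h c k1 k2 \<kappa>) * (2 * (S + 1) ^ 3))
    (Num (of_bool (\<exists>r\<in>set rs. Orc (level_query ds T dm \<alpha> \<lceil>\<alpha> / (kB * T) * r\<rceil>) \<and> r \<le> k)))"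
proof -
  define B where "B = 2 * (S + 1) ^ 3"
  have B_eq: "B = (S + 1) * (2 * (S + 1) * (S + 1))" by (simp add: B_def power3_eq_cube)
  have B1: "2 * (S + 1) * (S + 1) \<le> B" unfolding B_eq by simp
  have SB: "S < B" using B1 by (simp add: algebra_simps)
  let ?inp = "Cell ds (Cell (enc_rat T) dm)"
  let ?s0 = "(\<lambda>_. Num 0)(0 := x)"
  let ?s1 = "?s0(h := x)"
  let ?s2 = "?s1(0 := ?inp)"
  obtain u \<tau> where \<tau>: "exec (\<lambda>_. False) c ((\<lambda>_. Num 0)(0 := ?inp)) u \<tau>" "u \<le> t"
    "\<tau> 0 = enc_list enc_rat rs"
    using run by (auto simp: runs_within_def)
  define \<rho> where "\<rho> = (\<lambda>v. if v \<in> {..<h} then \<tau> v else ?s2 v)"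
  have exec3: "exec Orc c ?s2 u \<rho>"
    unfolding \<rho>_def by (rule exec_query_free_frame[OF \<tau>(1) c(2,1)]) auto
  have \<rho>: "\<rho> 0 = enc_list enc_rat rs" "\<rho> h = x"
    using assms(1) \<tau>(3) by (auto simp: \<rho>_def)
  have bd0: "bounded_store (bit_size x) ?s0"
    using bit_size_pos[of x] by (auto simp: bounded_store_def floorlog_def)
  then have bd1: "bounded_store (bit_size x) ?s1" by (intro bounded_store_upd[of _ ?s0]) auto
  then have bd2: "bounded_store (bit_size x) ?s2"
    by (intro bounded_store_upd[of _ ?s1]) (auto simp: x)
  then have "bounded_store (bit_size x + u) \<rho>"
    using exec_bit_size_le[OF exec3] unfolding bounded_store_def
    by (meson add_right_mono le_trans)
  then have bd3: "bounded_store S \<rho>"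
    using S \<tau>(2) by (elim bounded_store_mono) linarith
  have cells: "cells ds < S"
    using cells_less_bit_size[of ds] S by (simp add: x)
  have "bit_size (\<rho> 0) \<le> S" using bd3 by (auto simp: bounded_store_def)
  then have len: "Suc (length rs) \<le> S + 1"
    using length_le_cells_enc_list[of rs enc_rat] cells_less_bit_size[of "\<rho> 0"] \<rho>(1) by simp
  have "2 * S * (S + 1) \<le> B" using B1 by (simp add: algebra_simps)
  then obtain \<rho>4 where \<rho>4: "run Orc (setup_com h k1 k2 \<kappa>) \<rho> B \<rho>4" "bounded_store S \<rho>4"
    "\<rho>4 0 = enc_list enc_rat rs" "level_store h T ds dm k \<alpha> False \<rho>4"
    using run_setup_com[OF assms(1-3) kB _ bd3 cells, where dm = dm and k = k and \<kappa> = \<kappa> and B = B and Orc = Orc] S \<rho> x unfolding \<alpha> by fastforce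
  have "2 \<le> S" using S by linarith
  then obtain \<rho>5 where \<rho>5: "run Orc (level_loop h k1 k2) \<rho>4 (Suc (length rs) * ((S + 1) * (S + 1))) \<rho>5"
    "bounded_store S \<rho>5" "level_store h T ds dm k \<alpha>
      (False \<or> (\<exists>r\<in>set rs. Orc (level_query ds T dm \<alpha> \<lceil>\<alpha> / (kB * T) * r\<rceil>) \<and> r \<le> k)) \<rho>5"
    using run_level_loop[OF assms(1-3) \<rho>4(4,3) kB \<rho>4(2) le_refl _ fits] by blast
  have "Suc (length rs) * ((S + 1) * (S + 1)) \<le> (S + 1) * ((S + 1) * (S + 1))"
    using len by (rule mult_le_mono1)
  also have "\<dots> \<le> B" unfolding B_eq by (intro mult_le_mono2) simp
  finally have run5: "run Orc (level_loop h k1 k2) \<rho>4 B \<rho>5"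
    by (rule run_mono[OF \<rho>5(1)])
  have x_S: "bit_size x < B" using S SB by linarith
  let ?\<tau> = "\<rho>5(0 := val (Var (h + 12)) \<rho>5)"
  have "run Orc (Assign h (Var 0)) ?s0 B ?s1"
    using run_Assign[OF bd0 x_S, of Orc h "Var 0"] by simp
  moreover have "run Orc (Assign 0 (Left (Var 0))) ?s1 B ?s2"
    using run_Assign[OF bd1 x_S, of Orc 0 "Left (Var 0)"] assms(1) by (simp add: x)
  moreover have "run Orc c ?s2 B \<rho>"
    using exec_imp_run[OF exec3] \<tau>(2) S SB by simp
  moreover note \<rho>4(1) run5
  moreover have "run Orc (Assign 0 (Var (h + 12))) \<rho>5 B ?\<tau>"
    by (rule run_Assign[OF \<rho>5(2) SB])
  ultimately have "run Orc (reduction h c k1 k2 \<kappa>) ?s0 B ?\<tau>"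
    unfolding reduction_def by (intro run_Seq)
  then obtain t' where "exec Orc (reduction h c k1 k2 \<kappa>) ?s0 t' ?\<tau>"
    "t' \<le> ccoef (reduction h c k1 k2 \<kappa>) * B" by (auto simp: run_def)
  moreover have "?\<tau> 0 = Num (of_bool (\<exists>r\<in>set rs.
      Orc (level_query ds T dm \<alpha> \<lceil>\<alpha> / (kB * T) * r\<rceil>) \<and> r \<le> k))"
    using \<rho>5(3) by (simp add: level_store_def)
  ultimately show ?thesis unfolding runs_within_def B_def by blast
qed

lemma digits_le_imp:
  assumes "real (digits r) \<le> c * log 2 (real n + 2)"
  shows "\<bar>fst (quotient_of r)\<bar> \<le> int ((n + 2) ^ nat \<lceil>c\<rceil>)"
    and "snd (quotient_of r) \<le> int ((n + 2) ^ nat \<lceil>c\<rceil>)"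
proof -
  let ?\<kappa> = "nat \<lceil>c\<rceil>"
  have "real (digits r) \<le> c * log 2 (real n + 2)" by (fact assms)
  also have "\<dots> \<le> real ?\<kappa> * log 2 (real n + 2)"
    by (intro mult_right_mono) (auto simp: real_nat_ceiling_ge)
  also have "\<dots> = log 2 ((real n + 2) ^ ?\<kappa>)" by (simp add: log_nat_power)
  finally have "2 powr real (digits r) \<le> (real n + 2) ^ ?\<kappa>"
    by (subst (asm) le_log_iff) auto
  then have "real (2 ^ digits r) \<le> real ((n + 2) ^ ?\<kappa>)" by (simp add: powr_realpow add.commute)
  then have le: "2 ^ digits r \<le> (n + 2) ^ ?\<kappa>" by (simp only: of_nat_le_iff)
  have "nat \<bar>fst (quotient_of r)\<bar> < 2 ^ floorlog 2 (nat \<bar>fst (quotient_of r)\<bar>)"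
    by (rule less_power_floorlog)
  also have "\<dots> \<le> 2 ^ digits r" unfolding digits_def by (intro power_increasing) auto
  finally show "\<bar>fst (quotient_of r)\<bar> \<le> int ((n + 2) ^ ?\<kappa>)" using le by linarith
  have "nat (snd (quotient_of r)) < 2 ^ floorlog 2 (nat (snd (quotient_of r)))"
    by (rule less_power_floorlog)
  also have "\<dots> \<le> 2 ^ digits r" unfolding digits_def by (intro power_increasing) auto
  finally show "snd (quotient_of r) \<le> int ((n + 2) ^ ?\<kappa>)" using le by linarith
qed

lemma scale_mono: "m \<le> n \<Longrightarrow> scale \<kappa> m \<le> scale \<kappa> n"
  unfolding scale_def by (intro mult_le_mono add_le_mono power_mono) auto

lemma abs_level_exponent_le:
  assumes "0 < \<theta>" "\<bar>fst (quotient_of r)\<bar> \<le> int D" "0 < q"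
  shows "\<bar>\<lceil>magnification \<theta> q / \<theta> * r\<rceil>\<bar> \<le> int (2 * q * D)"
proof -
  have "\<bar>r\<bar> \<le> of_int \<bar>fst (quotient_of r)\<bar>" by (rule abs_rat_le_num)
  also have "\<dots> \<le> of_int (int D)" using assms(2) by (simp only: of_int_le_iff)
  finally have r: "\<bar>r\<bar> \<le> of_nat D" by simp
  have "\<bar>magnification \<theta> q / \<theta> * r\<bar> = (magnification \<theta> q / \<theta>) * \<bar>r\<bar>"
    using magnification_pos[OF assms(1,3)] assms(1) by (simp add: abs_mult)
  also have "\<dots> \<le> (2 * of_nat q) * of_nat D"
    using magnification_bounds(2)[OF assms(1,3)] r by (intro mult_mono) auto
  finally have "\<bar>magnification \<theta> q / \<theta> * r\<bar> \<le> of_int (int (2 * q * D))" by simp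
  then have "of_int (- int (2 * q * D)) \<le> magnification \<theta> q / \<theta> * r"
    "magnification \<theta> q / \<theta> * r \<le> of_int (int (2 * q * D))"
    unfolding abs_le_iff of_int_minus by linarith+
  then have "\<lceil>magnification \<theta> q / \<theta> * r\<rceil> \<le> int (2 * q * D)"
    "- int (2 * q * D) \<le> \<lceil>magnification \<theta> q / \<theta> * r\<rceil>"
    using ceiling_mono[of "of_int (- int (2 * q * D))" "magnification \<theta> q / \<theta> * r"]
    by (simp_all only: ceiling_le_iff ceiling_of_int)
  then show ?thesis by linarith
qed

definition polynomial_fun :: "(nat \<Rightarrow> nat) \<Rightarrow> bool" where
  "polynomial_fun f \<longleftrightarrow> (\<exists>p :: nat poly. \<forall>n. f n = poly p n)"

lemma polynomial_fun_intros:
  "polynomial_fun (\<lambda>n. c)"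
  "polynomial_fun (\<lambda>n. n)"
  "polynomial_fun (poly p)"
  "polynomial_fun f \<Longrightarrow> polynomial_fun g \<Longrightarrow> polynomial_fun (\<lambda>n. f n + g n)"
  "polynomial_fun f \<Longrightarrow> polynomial_fun g \<Longrightarrow> polynomial_fun (\<lambda>n. f n * g n)"
  "polynomial_fun f \<Longrightarrow> polynomial_fun (\<lambda>n. f n ^ k)"
proof -
  show "polynomial_fun (\<lambda>n. c)" unfolding polynomial_fun_def by (rule exI[of _ "[:c:]"]) simp
  show "polynomial_fun (\<lambda>n. n)" unfolding polynomial_fun_def by (rule exI[of _ "[:0, 1:]"]) simp
  show "polynomial_fun (poly p)" unfolding polynomial_fun_def by blast
  show "polynomial_fun f \<Longrightarrow> polynomial_fun g \<Longrightarrow> polynomial_fun (\<lambda>n. f n + g n)"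
    unfolding polynomial_fun_def by (metis poly_add)
  show "polynomial_fun f \<Longrightarrow> polynomial_fun g \<Longrightarrow> polynomial_fun (\<lambda>n. f n * g n)"
    unfolding polynomial_fun_def by (metis poly_mult)
  show "polynomial_fun f \<Longrightarrow> polynomial_fun (\<lambda>n. f n ^ k)"
    unfolding polynomial_fun_def by (metis poly_power)
qed

lemma poly_nat_mono: "m \<le> n \<Longrightarrow> poly p m \<le> poly p (n :: nat)"
  by (induction p) (auto intro!: mult_mono)

theorem theorem23:
  fixes kB :: rat
    and \<Omega> :: "strand list \<Rightarrow> sec_structure set"
    and \<Delta>G :: "'m \<Rightarrow> energy"
    and enc_model :: "'m \<Rightarrow> data"
    and Inp :: "(strand list \<times> rat \<times> 'm) set"
    and lev :: "strand list \<times> rat \<times> 'm \<Rightarrow> rat list"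
  assumes "kB > 0"
    and "inj enc_model"
    and "\<And>s T M. (s, T, M) \<in> Inp \<Longrightarrow> T > 0 \<and> \<Omega> s \<noteq> {} \<and> \<Omega> s \<subseteq> secondary_structures s"
    and "candidate_levels \<Omega> \<Delta>G enc_model Inp lev"
  shows "poly_turing_reducible (dMFE \<Omega> \<Delta>G enc_model Inp) (dPF kB \<Omega> \<Delta>G enc_model Inp)
           (\<lambda>(s, T, M, k) (s', T', (M', \<alpha>), k'). M' = M)"
proof -
  obtain k1 k2 where kB: "quotient_of kB = (k1, k2)" by force
  have levels: "\<Delta>G M s (of_rat T) ` \<Omega> s \<subseteq> of_rat ` set (lev (s, T, M))"
    if "(s, T, M) \<in> Inp" for s T M
    using assms(4) that unfolding candidate_levels_def by blast
  have "polytime_computable_on Inp (enc_input enc_model) (enc_list enc_rat) lev"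
    using assms(4) unfolding candidate_levels_def by (elim conjE)
  then obtain c p where c: "query_free c"
    "\<And>x. x \<in> Inp \<Longrightarrow> runs_within (\<lambda>_. False) c (enc_input enc_model x)
      (poly p (bit_size (enc_input enc_model x))) (enc_list enc_rat (lev x))"
    unfolding polytime_computable_on_def by (elim exE conjE) (rule that, assumption, erule bspec)
  have "\<exists>d :: real. \<forall>(s, T, M)\<in>Inp. \<forall>r\<in>set (lev (s, T, M)).
      real (digits r) \<le> d * log 2 (real (num_bases s) + 2)"
    using assms(4) unfolding candidate_levels_def by (elim conjE)
  then obtain d :: real where "\<And>s T M r. (s, T, M) \<in> Inp \<Longrightarrow> r \<in> set (lev (s, T, M)) \<Longrightarrow>
      real (digits r) \<le> d * log 2 (real (num_bases s) + 2)"
    by fast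
  then obtain \<kappa> where \<kappa>: "\<And>s T M r. (s, T, M) \<in> Inp \<Longrightarrow> r \<in> set (lev (s, T, M)) \<Longrightarrow>
      \<bar>fst (quotient_of r)\<bar> \<le> int ((num_bases s + 2) ^ \<kappa>) \<and>
      snd (quotient_of r) \<le> int ((num_bases s + 2) ^ \<kappa>)"
    using digits_le_imp by metis
  define h where "h = Suc (Max (insert 0 (cvars c)))"
  have h: "0 < h" "cvars c \<subseteq> {..<h}"
    using finite_cvars[of c] by (auto simp: h_def less_Suc_eq_le)
  define R where "R = reduction h c k1 k2 \<kappa>"
  define A where "A = (\<lambda>N. 2 * scale \<kappa> N * (N + 2) ^ \<kappa>)"
  define S where "S = (\<lambda>N. N + poly p N + (1 + scale \<kappa> N) + bit_size (Num k1) + bit_size (Num k2) + 2 + room (A N))"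
  have "polynomial_fun (\<lambda>N. ccoef R * (2 * (S N + 1) ^ 3))"
    unfolding S_def A_def room_def scale_def by (intro polynomial_fun_intros)
  then obtain P :: "nat poly" where P: "\<And>N. ccoef R * (2 * (S N + 1) ^ 3) = poly P N"
    unfolding polynomial_fun_def by blast
  have "runs_within Orc R (encode (dMFE \<Omega> \<Delta>G enc_model Inp) (s, T, M, k))
      (poly P (bit_size (encode (dMFE \<Omega> \<Delta>G enc_model Inp) (s, T, M, k))))
      (Num (of_bool (yes (dMFE \<Omega> \<Delta>G enc_model Inp) (s, T, M, k))))"
    if inp: "(s, T, M) \<in> Inp"
      and Orc: "\<forall>y\<in>instances (dPF kB \<Omega> \<Delta>G enc_model Inp).
        (\<lambda>(s', T', (M', \<alpha>), k'). M' = M) y \<longrightarrow>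
        Orc (encode (dPF kB \<Omega> \<Delta>G enc_model Inp) y) = yes (dPF kB \<Omega> \<Delta>G enc_model Inp) y"
    for s T M k Orc
  proof -
    let ?ds = "enc_strands s" and ?dm = "enc_model M" and ?rs = "lev (s, T, M)"
    define x where "x = Cell (Cell ?ds (Cell (enc_rat T) ?dm)) (enc_rat k)"
    define N where "N = bit_size x"
    define q where "q = scale \<kappa> (cells ?ds)"
    define \<alpha> where "\<alpha> = magnification (kB * T) q"
    have T: "0 < T" and \<Omega>: "\<Omega> s \<noteq> {}" "\<Omega> s \<subseteq> secondary_structures s"
      using assms(3)[OF inp] by auto
    have kBT: "0 < kB * T" using assms(1) T by simp
    have q0: "0 < q" by (simp add: q_def scale_pos)
    have inp_N: "bit_size (enc_input enc_model (s, T, M)) \<le> N"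
      by (simp add: N_def x_def enc_input_def)
    have cells_N: "cells ?ds \<le> N"
      using cells_less_bit_size[of ?ds] by (simp add: N_def x_def)
    have n_cells: "num_bases s \<le> cells ?ds" by (rule num_bases_le_cells)
    have q_N: "q \<le> scale \<kappa> N" unfolding q_def by (rule scale_mono[OF cells_N])
    have fits: "fits (S N) \<lceil>\<alpha> / (kB * T) * r\<rceil>" if r: "r \<in> set ?rs" for r
    proof (rule fits_room)
      have "2 * q * (num_bases s + 2) ^ \<kappa> \<le> A N"
        unfolding A_def using q_N n_cells cells_N by (intro mult_le_mono power_mono) auto
      then show "\<bar>\<lceil>\<alpha> / (kB * T) * r\<rceil>\<bar> \<le> int (A N)"
        using abs_level_exponent_le[OF kBT _ q0, of r "(num_bases s + 2) ^ \<kappa>"] \<kappa>[OF inp r]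
        unfolding \<alpha>_def by linarith
      show "room (A N) \<le> S N" by (simp add: S_def)
    qed
    have run: "runs_within Orc R x (ccoef R * (2 * (S N + 1) ^ 3))
      (Num (of_bool (\<exists>r\<in>set ?rs. Orc (level_query ?ds T ?dm \<alpha> \<lceil>\<alpha> / (kB * T) * r\<rceil>) \<and> r \<le> k)))"
      unfolding R_def
    proof (rule runs_within_reduction[OF h(1) assms(1) T kB h(2) c(1) _ x_def])
      show "runs_within (\<lambda>_. False) c (Cell ?ds (Cell (enc_rat T) ?dm))
        (poly p (bit_size (enc_input enc_model (s, T, M)))) (enc_list enc_rat ?rs)"
        using c(2)[OF inp] by (simp add: enc_input_def)
      show "\<alpha> = magnification (kB * T) (scale \<kappa> (cells ?ds))" by (simp add: \<alpha>_def q_def)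
      show "bit_size x + poly p (bit_size (enc_input enc_model (s, T, M))) +
          bit_size (Num (int (scale \<kappa> (cells ?ds)))) + bit_size (Num k1) + bit_size (Num k2) + 2 \<le> S N"
        using poly_nat_mono[OF inp_N, of p] bit_size_Num_le[of "int q"] q_N
        unfolding S_def N_def[symmetric] q_def[symmetric] by linarith
      show "fits (S N) \<lceil>\<alpha> / (kB * T) * r\<rceil>" if "r \<in> set ?rs" for r by (rule fits[OF that])
    qed
    have query: "Orc (level_query ?ds T ?dm \<alpha> \<lceil>\<alpha> / (kB * T) * r\<rceil>) \<longleftrightarrow>
        MFE \<Omega> (\<Delta>G M) s (of_rat T) \<le> of_rat r" if r: "r \<in> set ?rs" for r
    proof -
      let ?K = "threshold \<lceil>\<alpha> / (kB * T) * r\<rceil>"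
      let ?y = "(s, T, (M, \<alpha>), ?K)"
      have "?y \<in> instances (dPF kB \<Omega> \<Delta>G enc_model Inp)"
        using inp magnification_pos[OF kBT q0] by (simp add: dPF_def \<alpha>_def)
      with Orc have "Orc (encode (dPF kB \<Omega> \<Delta>G enc_model Inp) ?y) = yes (dPF kB \<Omega> \<Delta>G enc_model Inp) ?y"
        by auto
      then have "Orc (level_query ?ds T ?dm \<alpha> \<lceil>\<alpha> / (kB * T) * r\<rceil>) \<longleftrightarrow>
          of_rat ?K \<le> PF (of_rat kB) \<Omega> (magnify (of_rat \<alpha>) (\<Delta>G M)) s (of_rat T)"
        by (simp add: dPF_def level_query_def enc_input_def)
      also have "\<dots> \<longleftrightarrow> MFE \<Omega> (\<Delta>G M) s (of_rat T) \<le> of_rat r"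
        unfolding \<alpha>_def
      proof (rule threshold_le_PF_iff[where L = "set ?rs", OF assms(1) T])
        show "snd (quotient_of r) \<le> int ((num_bases s + 2) ^ \<kappa>)" if "r \<in> set ?rs" for r
          using \<kappa>[OF inp that] by simp
        show "((num_bases s)\<^sup>2 + 3) * ((num_bases s + 2) ^ \<kappa>)\<^sup>2 \<le> q"
          using scale_mono[OF n_cells, of \<kappa>] by (simp add: q_def scale_def)
      qed (use \<Omega> levels[OF inp] r q0 in auto)
      finally show ?thesis .
    qed
    have "finite (\<Omega> s)"
      using \<Omega>(2) finite_secondary_structures finite_subset by blast
    then have "MFE \<Omega> (\<Delta>G M) s (of_rat T) \<le> of_rat k \<longleftrightarrow>
        (\<exists>r\<in>set ?rs. MFE \<Omega> (\<Delta>G M) s (of_rat T) \<le> of_rat r \<and> r \<le> k)"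
      using \<Omega>(1) levels[OF inp] by (rule MFE_le_iff)
    also have "\<dots> \<longleftrightarrow>
        (\<exists>r\<in>set ?rs. Orc (level_query ?ds T ?dm \<alpha> \<lceil>\<alpha> / (kB * T) * r\<rceil>) \<and> r \<le> k)"
      using query by blast
    finally have yes: "yes (dMFE \<Omega> \<Delta>G enc_model Inp) (s, T, M, k) \<longleftrightarrow>
        (\<exists>r\<in>set ?rs. Orc (level_query ?ds T ?dm \<alpha> \<lceil>\<alpha> / (kB * T) * r\<rceil>) \<and> r \<le> k)"
      by (simp add: dMFE_def)
    have "encode (dMFE \<Omega> \<Delta>G enc_model Inp) (s, T, M, k) = x"
      by (simp add: dMFE_def x_def enc_input_def)
    then show ?thesis using run unfolding P yes N_def by (simp only:)
  qed
  note main = this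
  show ?thesis
    unfolding poly_turing_reducible_def
  proof (intro exI[of _ R] exI[of _ P] ballI allI impI)
    fix x Orc
    assume x: "x \<in> instances (dMFE \<Omega> \<Delta>G enc_model Inp)"
      and Orc: "\<forall>y\<in>instances (dPF kB \<Omega> \<Delta>G enc_model Inp).
        (case x of (s, T, M, k) \<Rightarrow> \<lambda>(s', T', (M', \<alpha>), k'). M' = M) y \<longrightarrow>
        Orc (encode (dPF kB \<Omega> \<Delta>G enc_model Inp) y) = yes (dPF kB \<Omega> \<Delta>G enc_model Inp) y"
    obtain s T M k where eq: "x = (s, T, M, k)" by (cases x)
    have "(s, T, M) \<in> Inp" using x by (simp add: eq dMFE_def)
    from main[OF this Orc[unfolded eq prod.case]] show "runs_within Orc R (encode (dMFE \<Omega> \<Delta>G enc_model Inp) x)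
      (poly P (bit_size (encode (dMFE \<Omega> \<Delta>G enc_model Inp) x)))
      (Num (of_bool (yes (dMFE \<Omega> \<Delta>G enc_model Inp) x)))"
      unfolding eq .
  qed
qed

end
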